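(* Let $m\in\mathbb{N}$, $n\in\mathbb{Z}$ and $\lambda\in\mathcal{Z}_{m,n}$. Then: 1. $\varphi^{(m)}_{n,\lambda}\in\mathcal{H}^{(m)}$. 2. $$\|\varphi^{(m)}_{n,\lambda}\|^2_{L^2,\infty}=\frac{J_n(\lambda)^2}{2}\Bigl(\frac{J_n'(\lambda)^2}{J_n(\lambda)^2}+\frac{J_{n-m}'(\lambda)^2}{J_{n-m}(\lambda)^2}\Bigr)+\frac{J_n(\lambda)^2}{2}\Bigl(2-\frac{(n-m)^2+n^2}{\lambda^2}\Bigr).$$ 3. For all $n,n'\in\mathbb{Z}$ and all $\lambda\in\mathcal{Z}_{m,n}$, $\lambda'\in\mathcal{Z}_{m,n'}$, $(\varphi^{(m)}_{n,\lambda},\varphi^{(m)}_{n',\lambda'})_{L^2,\infty}=\delta_{n,n'}\delta_{\lambda,\lambda'}(\varphi^{(m)}_{n,\lambda},\varphi^{(m)}_{n,\lambda})_{L^2,\infty}$. 4. $\mathcal{Z}_{m,n}$ is a discrete and infinite subset of $\mathbb{R}^*=\mathbb{R}\setminus\{0\}$.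
   Context: $\mathbb{N}=\{0,1,2,\dots\}$; $\delta_{a,b}$ is the Kronecker symbol. $\mathbb{P}^1$ is the complex projective line with homogeneous coordinates $[x_0:x_1]$ and affine coordinate $z=x_1/x_0=re^{i\theta}$. $A^{(0,0)}(\mathbb{P}^1,\mathcal{O}(m))$ is the space of $C^\infty$ global sections of $\mathcal{O}(m)$; the global section $1$ of $\mathcal{O}(m)$ corresponds to $x_0^m$, and $f\otimes1$ denotes $f$ times this section. Canonical metric on $\mathcal{O}(m)$: $h_m(s,s)(x)=|s(x)|^2/\max(|x_0|,|x_1|)^{2m}$, so $h_m(1,1)(z)=\max(1,|z|)^{-2m}$. Canonical Kähler form: $\omega_\infty=\frac{i}{2\pi}\frac{dz\wedge d\bar z}{\max(1,|z|)^4}$. Hermitian product: $(\xi,\xi')_{L^2,\infty}=\int_{\mathbb{P}^1}h_m(\xi,\xi')\,\omega_\infty$; $\mathcal{H}^{(m)}$ is the Hilbert completion of $A^{(0,0)}(\mathbb{P}^1,\mathcal{O}(m))$ for it. $J_n$ is the Bessel function of the first kind of integer order $n$. For $n\in\mathbb{Z}$, $L_{m,n}(z)=-z^m\frac{d}{dz}\bigl(z^{-m}J_n(z)J_{n-m}(z)\bigr)$ (entire after extension) and $\mathcal{Z}_{m,n}=\{\lambda\in\mathbb{C}^*: L_{m,n}(\lambda)=0\}$. For $\lambda\in\mathcal{Z}_{m,n}$ put $\varphi^{(m)}_{n,\lambda}=f^{(m)}_{n,\lambda}\otimes 1$, where: - if $m\ge1$ (it being taken that $J_n(\lambda)J_{n-m}(\lambda)\ne0$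 for $\lambda\in\mathcal{Z}_{m,n}$): $f^{(m)}_{n,\lambda}(re^{i\theta})=J_n(\lambda r)e^{in\theta}$ for $r<1$ and $\frac{J_n(\lambda)}{J_{n-m}(\lambda)}r^mJ_{n-m}(\lambda/r)e^{in\theta}$ for $r>1$; - if $m=0$ and $J_n'(\lambda)=0$: $f^{(0)}_{n,\lambda}(re^{i\theta})=J_n(\lambda r)e^{in\theta}$ for $r<1$ and $J_n(\lambda/r)e^{in\theta}$ for $r>1$; - if $m=0$ and $J_n(\lambda)=0$: $f^{(0)}_{n,\lambda}(re^{i\theta})=-J_n(\lambda r)e^{in\theta}$ for $r<1$ and $J_n(\lambda/r)e^{in\theta}$ for $r>1$.
   Formalization: In 2 the right side is doubled, as the given ω_∞ requires, and for m=0, J_n(λ)=0 it is read with J_n(λ)² cancelled; in 3 pairs n'=n, λ'=-λ are excluded, as φ_{n,-λ}=(-1)^n φ_{n,λ}; in 1–3, for m≥1, λ is restricted to J_n(λ)J_{n-m}(λ)≠0, where φ is defined. *)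

theory Defs
  imports "HOL-Analysis.Analysis"
begin

subsection \<open>Bessel functions of the first kind of integer order\<close>

definition bessel_J_nat :: "nat \<Rightarrow> complex \<Rightarrow> complex" where
  "bessel_J_nat n z = (\<Sum>k. (-1) ^ k / (fact k * fact (n + k)) * (z / 2) ^ (n + 2 * k))"

definition bessel_J :: "int \<Rightarrow> complex \<Rightarrow> complex" where
  "bessel_J n z = (if n \<ge> 0 then bessel_J_nat (nat n) z
                   else (-1) ^ nat (- n) * bessel_J_nat (nat (- n)) z)"

abbreviation bessel_J' :: "int \<Rightarrow> complex \<Rightarrow> complex" where
  "bessel_J' n \<equiv> deriv (bessel_J n)"

text \<open>The value at \<open>0\<close> of the function below is not the value of its entire extension, but
  \<open>0\<close> is excluded from the zero set anyway.\<close>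

definition L_fun :: "nat \<Rightarrow> int \<Rightarrow> complex \<Rightarrow> complex" where
  "L_fun m n z = - (z ^ m) * deriv (\<lambda>w. bessel_J n w * bessel_J (n - int m) w / w ^ m) z"

definition Z_set :: "nat \<Rightarrow> int \<Rightarrow> complex set" where
  "Z_set m n = {l. l \<noteq> 0 \<and> L_fun m n l = 0}"

subsection \<open>Sections of \<open>O(m)\<close> on the projective line\<close>

text \<open>A (set-theoretic) section of \<open>O(m)\<close> is a function on \<open>\<complex>\<^sup>2\<close> minus the origin that is
  homogeneous of degree \<open>m\<close>; the value at the origin carries no information.
  Its representatives in the frames \<open>x\<^sub>0\<^sup>m\<close> and \<open>x\<^sub>1\<^sup>m\<close> are \<open>\<lambda>z. s 1 z\<close>
  (in the coordinate \<open>z = x\<^sub>1/x\<^sub>0\<close>) and \<open>\<lambda>w. s w 1\<close> (in the coordinate \<open>w = x\<^sub>0/x\<^sub>1\<close>).\<close>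

type_synonym section_rep = "complex \<Rightarrow> complex \<Rightarrow> complex"

definition is_section :: "nat \<Rightarrow> section_rep \<Rightarrow> bool" where
  "is_section m s \<longleftrightarrow>
     (\<forall>c x0 x1. c \<noteq> 0 \<longrightarrow> (x0, x1) \<noteq> (0, 0) \<longrightarrow> s (c * x0) (c * x1) = c ^ m * s x0 x1)"

text \<open>Differentiability is over the reals: all iterated directional derivatives of the
  Frechet derivative exist and are continuous.\<close>

primrec C_k :: "nat \<Rightarrow> (complex \<Rightarrow> complex) \<Rightarrow> bool" where
  "C_k 0 f \<longleftrightarrow> continuous_on UNIV f"
| "C_k (Suc k) f \<longleftrightarrow> (\<forall>x. f differentiable (at x)) \<and>
                     (\<forall>v. C_k k (\<lambda>x. frechet_derivative f (at x) v))"

definition C_infinity :: "(complex \<Rightarrow> complex) \<Rightarrow> bool" where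
  "C_infinity f \<longleftrightarrow> (\<forall>k. C_k k f)"

definition smooth_sections :: "nat \<Rightarrow> section_rep set" where
  "smooth_sections m =
     {s. is_section m s \<and> C_infinity (\<lambda>z. s 1 z) \<and> C_infinity (\<lambda>w. s w 1)}"

subsection \<open>Canonical metric, canonical form and Hermitian product\<close>

definition h_metric :: "nat \<Rightarrow> section_rep \<Rightarrow> section_rep \<Rightarrow> complex \<Rightarrow> complex \<Rightarrow> complex" where
  "h_metric m s t x0 x1 =
     s x0 x1 * cnj (t x0 x1) / of_real (max (norm x0) (norm x1) ^ (2 * m))"

text \<open>Since \<open>dz \<and> d\<zbar>\<close> is \<open>-2i dx \<and> dy\<close>, the form \<open>(i / 2\<pi>) dz \<and> d\<zbar>\<close> is Lebesgue
  measure divided by \<open>\<pi>\<close>.  The total mass of the measure below is \<open>2\<close>.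
  The point at infinity is a null set, so the affine chart suffices.\<close>

definition omega_inf :: "complex measure" where
  "omega_inf = density lborel (\<lambda>z. ennreal (1 / pi * (1 / max 1 (norm z) ^ 4)))"

definition L2_inner :: "nat \<Rightarrow> section_rep \<Rightarrow> section_rep \<Rightarrow> complex" where
  "L2_inner m s t = (\<integral>z. h_metric m s t 1 z \<partial>omega_inf)"

definition L2_norm :: "nat \<Rightarrow> section_rep \<Rightarrow> real" where
  "L2_norm m s = sqrt (Re (L2_inner m s s))"

definition L2_sections :: "nat \<Rightarrow> section_rep set" where
  "L2_sections m =
     {s. is_section m s \<and> (\<lambda>z. s 1 z) \<in> borel_measurable borel \<and>
         integrable omega_inf (\<lambda>z. h_metric m s s 1 z)}"

text \<open>The Hilbert completion of the smooth sections, realised as their closure in the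
  (complete) space of square-integrable sections.  Elements are representatives of
  classes modulo equality almost everywhere.\<close>

definition H_space :: "nat \<Rightarrow> section_rep set" where
  "H_space m =
     {s \<in> L2_sections m.
        \<exists>t. (\<forall>k. t k \<in> smooth_sections m) \<and>
            (\<lambda>k::nat. L2_norm m (\<lambda>x0 x1. s x0 x1 - t k x0 x1)) \<longlonglongrightarrow> 0}"

subsection \<open>The sections \<open>\<phi>\<close>\<close>

text \<open>The second argument of the function below is \<open>\<lambda> \<in> Z_set m n\<close>, so for \<open>m = 0\<close> the
  last branch is the case \<open>J\<^sub>n(\<lambda>) = 0\<close>.  The circle \<open>r = 1\<close> is a null set; there the
  formula for \<open>r > 1\<close> is used.\<close>

definition f_fun :: "nat \<Rightarrow> int \<Rightarrow> complex \<Rightarrow> complex \<Rightarrow> complex" where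
  "f_fun m n l z =
     (let r = norm z; e = cis (of_int n * Arg z) in
      if m \<ge> 1 then
        (if r < 1 then bessel_J n (l * of_real r) * e
         else bessel_J n l / bessel_J (n - int m) l * of_real r ^ m
              * bessel_J (n - int m) (l / of_real r) * e)
      else if bessel_J' n l = 0 then
        (if r < 1 then bessel_J n (l * of_real r) * e
         else bessel_J n (l / of_real r) * e)
      else
        (if r < 1 then - bessel_J n (l * of_real r) * e
         else bessel_J n (l / of_real r) * e))"

text \<open>\<open>f \<otimes> 1\<close> is \<open>f\<close> times the section \<open>x\<^sub>0\<^sup>m\<close>; its value at the point \<open>x\<^sub>0 = 0\<close> is irrelevant.\<close>

definition tensor_one :: "nat \<Rightarrow> (complex \<Rightarrow> complex) \<Rightarrow> section_rep" where
  "tensor_one m f = (\<lambda>x0 x1. f (x1 / x0) * x0 ^ m)"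

definition phi :: "nat \<Rightarrow> int \<Rightarrow> complex \<Rightarrow> section_rep" where
  "phi m n l = tensor_one m (f_fun m n l)"

text \<open>The elements of \<open>Z_set m n\<close> for which \<open>\<phi>\<close> is defined.  For \<open>m \<ge> 1\<close> the quotient
  \<open>J\<^sub>n(\<lambda>) / J\<^sub>n\<^sub>-\<^sub>m(\<lambda>)\<close> has to make sense and be nonzero, which fails at the zeros of
  \<open>J\<^sub>n\<close> if \<open>m = 2n\<close>.\<close>

definition Z_adm :: "nat \<Rightarrow> int \<Rightarrow> complex set" where
  "Z_adm m n =
     {l \<in> Z_set m n. m \<ge> 1 \<longrightarrow> bessel_J n l * bessel_J (n - int m) l \<noteq> 0}"

end

theory Submission
  imports Defs "HOL-Complex_Analysis.Conformal_Mappings"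
begin

text \<open>
  The section \<open>\<phi>\<close> is a Bessel mode of angular frequency \<open>n\<close> on the disc \<open>|z| < 1\<close>, glued along the
  unit circle to a Bessel mode of the other disc, read in the coordinate \<open>1 / z\<close>.  Write \<open>k = n - m\<close>.
  If the two modes carry the amplitudes \<open>a\<close> and \<open>b\<close>, the gluing is governed by two transmission
  conditions, \<open>a J\<^sub>n(\<lambda>) = b J\<^sub>k(\<lambda>)\<close> and \<open>a \<lambda> J\<^sub>n'(\<lambda>) + b \<lambda> J\<^sub>k'(\<lambda>) = m a J\<^sub>n(\<lambda>)\<close>: continuity
  of the section and of its normal derivative, where the twist by \<open>z\<^sup>m\<close> contributes the right-hand
  side.  They can be satisfied with \<open>(a, b) \<noteq> 0\<close> exactly when \<open>L\<^sub>m\<^sub>,\<^sub>n(\<lambda>) = 0\<close>, and the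
  case distinction in the definition of \<open>\<phi>\<close> only serves to choose \<open>a\<close> and \<open>b\<close>
  (\<open>transmission_Z_adm\<close>).

  Since the canonical form and the canonical metric turn each half of the sphere into a flat unit
  disc, the product of two such sections of the same frequency is
  \<open>2 (a a' I\<^sub>n + b b' I\<^sub>k)\<close>, where \<open>I\<^sub>n\<close> is the Lommel integral of \<open>r J\<^sub>n(\<lambda> r) J\<^sub>n(\<lambda>' r)\<close> over
  \<open>[0, 1]\<close>.  Bessel's equation expresses \<open>(\<lambda>\<^sup>2 - \<lambda>'\<^sup>2) I\<^sub>n\<close> by boundary values at \<open>r = 1\<close>, and the
  transmission conditions make the boundary terms of the two discs cancel
  (\<open>transmission_orthogonal\<close>).  The diagonal Lommel integral gives the norm.  Sections of different
  frequencies are orthogonal because a rotation multiplies their product by a nontrivial character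
  (\<open>omega_inf_rotation_zero\<close>).

  The same cancellation, applied to \<open>\<lambda>\<close> and its conjugate, proves that \<open>\<lambda>\<^sup>2\<close> is real: otherwise a
  sum of positive numbers would vanish.  On the imaginary axis \<open>z J\<^sub>n'(z) / J\<^sub>n(z)\<close> is real and
  larger than \<open>|n|\<close>, whereas a zero of \<open>L\<close> would need \<open>z J\<^sub>n' / J\<^sub>n + z J\<^sub>k' / J\<^sub>k = m \<le> |n| + |k|\<close>;
  so the zeros are real (\<open>Z_set_real\<close>).  They are isolated as zeros of a nontrivial entire function.
  There are infinitely many because \<open>J\<^sub>n\<close> oscillates on the real axis and Rolle's theorem applies
  to \<open>J\<^sub>n J\<^sub>k / x\<^sup>m\<close>.

  For membership in the completion (\<open>H_spaceI\<close>), both halves of \<open>\<phi>\<close> are power series in the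
  coordinate and its conjugate.  Their partial sums are cut off by the factor
  \<open>|x\<^sub>0|\<^sup>2\<^sup>K / (|x\<^sub>0|\<^sup>2\<^sup>K + |x\<^sub>1|\<^sup>2\<^sup>K)\<close>, which for large \<open>K\<close> tends to \<open>1\<close> on one disc and to \<open>0\<close> on the other
  while keeping the products smooth on the whole sphere; dominated convergence does the rest.
\<close>

section \<open>Bessel functions through their power series\<close>

definition bessel_coeff :: "nat \<Rightarrow> nat \<Rightarrow> complex" where
  "bessel_coeff a k = (- 1 / 4) ^ k / (fact k * fact (a + k))"

text \<open>The series with \<open>J\<^sub>a(z) = (z / 2)\<^sup>a bessel_series a (z\<^sup>2)\<close>.  Working with the argument
  \<open>t = z\<^sup>2\<close> turns differentiation and Bessel's equation into index shifts \<open>a \<mapsto> a + 1\<close>.\<close>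

definition bessel_series :: "nat \<Rightarrow> complex \<Rightarrow> complex" where
  "bessel_series a t = (\<Sum>k. bessel_coeff a k * t ^ k)"

lemma norm_bessel_coeff_le: "norm (bessel_coeff a k) \<le> 1 / fact k"
proof -
  have "norm (bessel_coeff a k) = (1 / 4) ^ k / (fact k * fact (a + k))"
    by (simp add: bessel_coeff_def norm_divide norm_mult norm_power)
  also have "\<dots> \<le> 1 / (fact k * 1)"
    by (intro frac_le mult_left_mono power_le_one) auto
  finally show ?thesis by simp
qed

lemma summable_norm_bessel: "summable (\<lambda>k. norm (bessel_coeff a k * t ^ k))"
proof (rule summable_comparison_test')
  show "summable (\<lambda>k. inverse (fact k) * norm t ^ k)" by (rule summable_exp)
  show "norm (norm (bessel_coeff a k * t ^ k)) \<le> inverse (fact k) * norm t ^ k" for k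
    using mult_right_mono[OF norm_bessel_coeff_le[of a k], of "norm t ^ k"]
    by (simp add: norm_mult norm_power divide_simps)
qed

lemma summable_bessel: "summable (\<lambda>k. bessel_coeff a k * t ^ k)"
  by (rule summable_norm_cancel[OF summable_norm_bessel])

lemma bessel_series_0: "bessel_series a 0 = 1 / fact a"
  unfolding bessel_series_def powser_zero by (simp add: bessel_coeff_def)

lemma diffs_bessel_coeff: "diffs (bessel_coeff a) = (\<lambda>k. - (1 / 4) * bessel_coeff (Suc a) k)"
proof
  fix k
  have f: "fact (Suc k) = (of_nat (Suc k) * fact k :: complex)" by (rule fact_Suc)
  have "of_nat (Suc k) \<noteq> (0::complex)" by (rule of_nat_neq_0)
  then show "diffs (bessel_coeff a) k = - (1 / 4) * bessel_coeff (Suc a) k"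
    unfolding diffs_def bessel_coeff_def f by (simp add: divide_simps del: fact_Suc of_nat_Suc)
qed

lemma DERIV_bessel_series:
  "(bessel_series a has_field_derivative - (1 / 4) * bessel_series (Suc a) t) (at t)"
proof -
  have "((\<lambda>t. \<Sum>k. bessel_coeff a k * t ^ k) has_field_derivative
          (\<Sum>k. diffs (bessel_coeff a) k * t ^ k)) (at t)"
    by (rule termdiffs_strong_converges_everywhere) (rule summable_bessel)
  also have "(\<Sum>k. diffs (bessel_coeff a) k * t ^ k) = - (1 / 4) * bessel_series (Suc a) t"
    unfolding diffs_bessel_coeff bessel_series_def
    by (subst suminf_mult[symmetric, OF summable_bessel]) (simp add: mult.assoc)
  finally show ?thesis unfolding bessel_series_def .
qed

text \<open>Coefficientwise this is \<open>(a + 1) + k = a + k + 1\<close>.  As differentiation raises \<open>a\<close> by one, it is a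
  second-order differential equation for \<open>bessel_series a\<close>.\<close>

lemma bessel_series_recurrence:
  "bessel_series a t = of_nat (Suc a) * bessel_series (Suc a) t - t / 4 * bessel_series (Suc (Suc a)) t"
proof -
  let ?c = "bessel_coeff (Suc (Suc a))"
  have shift: "(\<lambda>k. (if k = 0 then 0 else ?c (k - 1)) * t ^ k) sums (t * bessel_series (Suc (Suc a)) t)"
  proof -
    have "(\<lambda>k. t * (?c k * t ^ k)) sums (t * bessel_series (Suc (Suc a)) t)"
      unfolding bessel_series_def by (intro sums_mult summable_sums summable_bessel)
    then have "(\<lambda>k. (if Suc k = 0 then 0 else ?c (Suc k - 1)) * t ^ Suc k) sums
        (t * bessel_series (Suc (Suc a)) t)"
      by (simp add: mult_ac)
    then show ?thesis by (subst (asm) sums_Suc_iff) simp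
  qed
  have coeff: "bessel_coeff a k = of_nat (Suc a) * bessel_coeff (Suc a) k
      - 1 / 4 * (if k = 0 then 0 else ?c (k - 1))" for k
  proof (cases k)
    case 0
    then show ?thesis by (simp add: bessel_coeff_def divide_simps del: of_nat_Suc)
  next
    case (Suc j)
    define X where "X = (- 1 / 4 :: complex) ^ j"
    have "fact (a + Suc j) \<noteq> (0::complex)" "fact j \<noteq> (0::complex)"
      "of_nat (Suc j) \<noteq> (0::complex)" "of_nat (Suc (Suc a + j)) \<noteq> (0::complex)"
      by (simp_all del: of_nat_Suc)
    moreover have "fact (Suc j) = (of_nat (Suc j) * fact j :: complex)"
      "fact (Suc (Suc a) + j) = (of_nat (Suc (Suc a + j)) * fact (a + Suc j) :: complex)"
      "fact (Suc a + Suc j) = (of_nat (Suc (Suc a + j)) * fact (a + Suc j) :: complex)"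
      by simp_all
    ultimately have "- (1/4) * X / (fact (Suc j) * fact (a + Suc j)) =
       of_nat (Suc a) * (- (1/4) * X / (fact (Suc j) * fact (Suc a + Suc j)))
         - 1 / 4 * (X / (fact j * fact (Suc (Suc a) + j)))"
      by (simp only:) (simp add: divide_simps del: fact_Suc, simp add: algebra_simps)
    then show ?thesis by (simp add: bessel_coeff_def Suc X_def del: fact_Suc of_nat_Suc)
  qed
  have "(\<lambda>k. of_nat (Suc a) * (bessel_coeff (Suc a) k * t ^ k)
         - 1 / 4 * ((if k = 0 then 0 else ?c (k - 1)) * t ^ k)) sums
      (of_nat (Suc a) * bessel_series (Suc a) t - 1 / 4 * (t * bessel_series (Suc (Suc a)) t))"
    by (intro sums_diff sums_mult shift) (auto simp: bessel_series_def intro: summable_sums summable_bessel)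
  then have "(\<lambda>k. bessel_coeff a k * t ^ k) sums
      (of_nat (Suc a) * bessel_series (Suc a) t - t / 4 * bessel_series (Suc (Suc a)) t)"
    by (subst coeff) (simp add: algebra_simps)
  then show ?thesis
    unfolding bessel_series_def[of a] by (rule sums_unique[symmetric])
qed

text \<open>The sign in \<open>J\<^sub>n = \<plusminus> J\<^sub>|\<^sub>n\<^sub>|\<close>; with it all integer orders share one formula.\<close>

definition bessel_sign :: "int \<Rightarrow> complex" where
  "bessel_sign n = (if n \<ge> 0 then 1 else (- 1) ^ nat (- n))"

lemma bessel_sign_nonzero: "bessel_sign n \<noteq> 0"
  by (simp add: bessel_sign_def)

lemma bessel_J_series:
  "bessel_J n z = bessel_sign n * (z / 2) ^ nat \<bar>n\<bar> * bessel_series (nat \<bar>n\<bar>) (z\<^sup>2)"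
proof -
  have nat: "bessel_J_nat a z = (z / 2) ^ a * bessel_series a (z\<^sup>2)" for a
  proof -
    have "(- 1) ^ k / (fact k * fact (a + k)) * (z / 2) ^ (a + 2 * k)
        = (z / 2) ^ a * (bessel_coeff a k * (z\<^sup>2) ^ k)" for k
    proof -
      have "(- 1 / 4) ^ k * (z\<^sup>2) ^ k = (- 1 * (z / 2)\<^sup>2) ^ k"
        unfolding power_mult_distrib[symmetric] by (simp add: power2_eq_square)
      also have "\<dots> = (- 1) ^ k * (z / 2) ^ (2 * k)"
        unfolding power_mult_distrib power_mult ..
      finally show ?thesis
        by (simp add: bessel_coeff_def power_add)
    qed
    then show ?thesis
      unfolding bessel_J_nat_def bessel_series_def by (simp add: suminf_mult summable_bessel)
  qed
  show ?thesis by (simp add: bessel_J_def bessel_sign_def nat)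
qed

lemma DERIV_bessel_series_square:
  "((\<lambda>z. bessel_series a (z\<^sup>2)) has_field_derivative - (z / 2) * bessel_series (Suc a) (z\<^sup>2)) (at z)"
proof -
  have "((\<lambda>z. z\<^sup>2) has_field_derivative 2 * z) (at z)"
    by (auto intro!: derivative_eq_intros)
  from DERIV_chain2[OF DERIV_bessel_series this] show ?thesis
    by (simp add: mult_ac)
qed

lemma DERIV_half_power:
  "((\<lambda>z. (z / 2) ^ a) has_field_derivative of_nat a * (z / 2) ^ (a - 1) / 2) (at (z :: complex))"
  by (rule derivative_eq_intros refl | simp)+

lemma DERIV_bessel_aux:
  "((\<lambda>z. c * (z / 2) ^ a * bessel_series a (z\<^sup>2)) has_field_derivative
     c * (of_nat a * (z / 2) ^ (a - 1) / 2 * bessel_series a (z\<^sup>2)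
       - (z / 2) ^ a * (z / 2) * bessel_series (Suc a) (z\<^sup>2))) (at z)"
proof -
  note d = DERIV_cmult[OF DERIV_mult[OF DERIV_half_power[of a z] DERIV_bessel_series_square[of a z]], of c]
  show ?thesis
    by (rule DERIV_cong[OF d[unfolded mult.assoc[symmetric]]]) (simp add: algebra_simps)
qed

lemma DERIV_bessel_J: "(bessel_J n has_field_derivative bessel_J' n z) (at z)"
proof -
  have "bessel_J n = (\<lambda>z. bessel_sign n * (z / 2) ^ nat \<bar>n\<bar> * bessel_series (nat \<bar>n\<bar>) (z\<^sup>2))"
    by (rule ext) (rule bessel_J_series)
  then have "bessel_J n field_differentiable (at z)"
    unfolding field_differentiable_def
    using DERIV_bessel_aux[of "bessel_sign n" "nat \<bar>n\<bar>" z] by auto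
  then show ?thesis
    by (simp only: DERIV_deriv_iff_field_differentiable)
qed

lemma holomorphic_bessel_J: "bessel_J n holomorphic_on A"
proof (rule holomorphic_on_subset)
  show "bessel_J n holomorphic_on UNIV"
    using DERIV_bessel_J by (auto simp: holomorphic_on_open)
qed auto

text \<open>The Euler derivative \<open>z J'(z)\<close>, unlike \<open>J'(z)\<close>, has a formula without the exponent
  \<open>|n| - 1\<close>, and it is what enters the boundary terms.\<close>

lemma euler_bessel_J:
  defines "a n \<equiv> nat \<bar>n\<bar>"
  shows "z * bessel_J' n z = bessel_sign n * (z / 2) ^ a n *
     (of_nat (a n) * bessel_series (a n) (z\<^sup>2) - z\<^sup>2 / 2 * bessel_series (Suc (a n)) (z\<^sup>2))"
proof -
  define b s B C where "b = a n" and "s = bessel_sign n" and "B = bessel_series b (z\<^sup>2)"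
    and "C = bessel_series (Suc b) (z\<^sup>2)"
  have "bessel_J n = (\<lambda>z. s * (z / 2) ^ b * bessel_series b (z\<^sup>2))"
    by (rule ext) (simp only: bessel_J_series b_def a_def s_def)
  then have "bessel_J' n z = s * (of_nat b * (z / 2) ^ (b - 1) / 2 * B - (z / 2) ^ b * (z / 2) * C)"
    using DERIV_imp_deriv[OF DERIV_bessel_aux[of s b z]] unfolding B_def C_def by simp
  then have "z * bessel_J' n z
      = z * (s * (of_nat b * (z / 2) ^ (b - 1) / 2 * B - (z / 2) ^ b * (z / 2) * C))"
    by (simp only:)
  also have "\<dots> = s * (of_nat b * (z / 2) ^ (b - 1) * (z / 2) * B - (z / 2) ^ b * (z\<^sup>2 / 2) * C)"
    by (simp add: power2_eq_square algebra_simps)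
  also have "of_nat b * (z / 2) ^ (b - 1) * (z / 2) = of_nat b * (z / 2) ^ b"
    by (cases b) simp_all
  finally show ?thesis
    unfolding b_def[symmetric] s_def[symmetric] B_def[symmetric] C_def[symmetric]
    by (simp add: algebra_simps)
qed

text \<open>Bessel's equation.  After inserting the series it is the three-term recurrence
  \<open>bessel_series_recurrence\<close>.  In this divergence form it integrates directly against a second
  Bessel function.\<close>

lemma bessel_equation:
  assumes "z \<noteq> 0"
  shows "((\<lambda>z. z * bessel_J' n z) has_field_derivative
          (of_int n ^ 2 - z\<^sup>2) / z * bessel_J n z) (at z)"
proof -
  define a where "a = nat \<bar>n\<bar>"
  have n: "of_int n ^ 2 = (of_nat a ^ 2 :: complex)"
    by (metis a_def of_int_of_nat_eq of_int_power power2_abs abs_ge_zero nat_0_le)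
  have rec: "bessel_series a (z\<^sup>2) = of_nat (Suc a) * bessel_series (Suc a) (z\<^sup>2)
      - z\<^sup>2 / 4 * bessel_series (Suc (Suc a)) (z\<^sup>2)"
    by (rule bessel_series_recurrence)
  have p: "of_nat a * (z / 2) ^ (a - 1) / 2 = of_nat a * (z / 2) ^ a / z"
    using assms by (cases a) simp_all
  define B0 B1 B2 where "B0 = bessel_series a (z\<^sup>2)" and "B1 = bessel_series (Suc a) (z\<^sup>2)"
    and "B2 = bessel_series (Suc (Suc a)) (z\<^sup>2)"
  have sq: "((\<lambda>z. z\<^sup>2 / 2) has_field_derivative z) (at z)"
    by (auto intro!: derivative_eq_intros)
  define X where "X = (z / 2) ^ a"
  have "((\<lambda>z. bessel_sign n * ((z / 2) ^ a *
      (of_nat a * bessel_series a (z\<^sup>2) - z\<^sup>2 / 2 * bessel_series (Suc a) (z\<^sup>2))))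
     has_field_derivative bessel_sign n * (of_nat a * (z / 2) ^ (a - 1) / 2 *
        (of_nat a * B0 - z\<^sup>2 / 2 * B1) + (of_nat a * (- (z / 2) * B1)
         - (z * B1 + - (z / 2) * B2 * (z\<^sup>2 / 2))) * (z / 2) ^ a)) (at z)"
    unfolding B0_def B1_def B2_def
    by (intro DERIV_cmult DERIV_mult DERIV_diff DERIV_half_power DERIV_bessel_series_square sq)
  moreover have "bessel_sign n * (of_nat a * (z / 2) ^ (a - 1) / 2 *
        (of_nat a * B0 - z\<^sup>2 / 2 * B1) + (of_nat a * (- (z / 2) * B1)
         - (z * B1 + - (z / 2) * B2 * (z\<^sup>2 / 2))) * (z / 2) ^ a)
     = (of_int n ^ 2 - z\<^sup>2) / z * bessel_J n z"
  proof -
    have "z * (of_nat a * X / z * (of_nat a * B0 - z\<^sup>2 / 2 * B1) + (of_nat a * (- (z / 2) * B1)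
         - (z * B1 + - (z / 2) * B2 * (z\<^sup>2 / 2))) * X)
       = (z * (of_nat a * X / z)) * (of_nat a * B0 - z\<^sup>2 / 2 * B1) + z * ((of_nat a * (- (z / 2) * B1)
         - (z * B1 + - (z / 2) * B2 * (z\<^sup>2 / 2))) * X)"
      by (simp only: distrib_left mult.assoc)
    also have "z * (of_nat a * X / z) = of_nat a * X"
      using assms by simp
    also have "of_nat a * X * (of_nat a * B0 - z\<^sup>2 / 2 * B1) + z * ((of_nat a * (- (z / 2) * B1)
         - (z * B1 + - (z / 2) * B2 * (z\<^sup>2 / 2))) * X)
       = X * (of_nat a ^ 2 * B0 - z\<^sup>2 * (of_nat (Suc a) * B1 - z\<^sup>2 / 4 * B2))"
      by (simp add: algebra_simps power2_eq_square)
    also have "\<dots> = (of_nat a ^ 2 - z\<^sup>2) * (X * B0)"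
      unfolding B0_def B1_def B2_def rec[symmetric] by (simp add: algebra_simps)
    also have "\<dots> = z * ((of_nat a ^ 2 - z\<^sup>2) / z * (X * B0))"
      using assms by simp
    finally have "of_nat a * X / z * (of_nat a * B0 - z\<^sup>2 / 2 * B1) + (of_nat a * (- (z / 2) * B1)
         - (z * B1 + - (z / 2) * B2 * (z\<^sup>2 / 2))) * X = (of_nat a ^ 2 - z\<^sup>2) / z * (X * B0)"
      by (simp only: mult_left_cancel[OF assms])
    then show ?thesis
      unfolding bessel_J_series n a_def[symmetric] p B0_def[symmetric] X_def[symmetric]
      by (simp only:) (simp add: mult_ac)
  qed
  ultimately have "((\<lambda>z. bessel_sign n * (z / 2) ^ a *
      (of_nat a * bessel_series a (z\<^sup>2) - z\<^sup>2 / 2 * bessel_series (Suc a) (z\<^sup>2)))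
     has_field_derivative (of_int n ^ 2 - z\<^sup>2) / z * bessel_J n z) (at z)"
    by (simp add: mult.assoc)
  then show ?thesis unfolding euler_bessel_J a_def .
qed

lemma cnj_bessel_series: "bessel_series a (cnj t) = cnj (bessel_series a t)"
proof -
  have "(\<lambda>k. cnj (bessel_coeff a k * t ^ k)) sums cnj (bessel_series a t)"
    unfolding sums_cnj bessel_series_def by (rule summable_sums[OF summable_bessel])
  then show ?thesis
    unfolding bessel_series_def[of a "cnj t"] by (simp add: bessel_coeff_def sums_iff)
qed

lemma cnj_bessel_sign: "cnj (bessel_sign n) = bessel_sign n"
  by (simp add: bessel_sign_def)

lemma cnj_bessel_J: "bessel_J n (cnj z) = cnj (bessel_J n z)"
  by (simp add: bessel_J_series cnj_bessel_sign flip: cnj_bessel_series)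

lemma cnj_bessel_J': "bessel_J' n (cnj z) = cnj (bessel_J' n z)"
proof -
  have "cnj \<circ> bessel_J n \<circ> cnj = bessel_J n"
    by (rule ext) (simp add: cnj_bessel_J)
  moreover have "(cnj \<circ> bessel_J n \<circ> cnj has_field_derivative cnj (bessel_J' n z)) (at (cnj z))"
    using DERIV_bessel_J[of n z] by (intro has_field_derivative_cnj_cnj) simp
  ultimately show ?thesis
    by (metis DERIV_imp_deriv)
qed

text \<open>At negative arguments the signs of the series cancel.\<close>

lemma bessel_series_pos:
  assumes "s \<ge> 0"
  obtains c where "c > 0" "bessel_series a (- of_real s) = of_real c"
proof
  define f where "f k = (s / 4) ^ k / (fact k * fact (a + k))" for k :: nat
  have f: "bessel_coeff a k * (- of_real s) ^ k = of_real (f k)" for k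
  proof -
    have "(- 1 / 4) ^ k * (- of_real s) ^ k = complex_of_real (s / 4) ^ k"
      unfolding power_mult_distrib[symmetric] by simp
    then show ?thesis
      by (simp add: f_def bessel_coeff_def)
  qed
  have sf: "summable f"
    using summable_bessel[of a "- of_real s"] unfolding f summable_complex_of_real .
  show "bessel_series a (- of_real s) = of_real (suminf f)"
    unfolding bessel_series_def f by (rule suminf_of_real[OF sf, symmetric])
  show "suminf f > 0"
    by (rule suminf_pos2[OF sf, of 0]) (auto simp: f_def assms)
qed

text \<open>By the Euler derivative, the logarithmic derivative at \<open>z = i y\<close> is \<open>|n|\<close> plus
  \<open>y\<^sup>2 / 2\<close> times a quotient of two positive series.\<close>

lemma bessel_J_imaginary:
  assumes "y \<noteq> 0"
  shows "bessel_J n (\<i> * of_real y) \<noteq> 0"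
    and "\<exists>q::real. q > real_of_int \<bar>n\<bar> \<and>
      \<i> * of_real y * bessel_J' n (\<i> * of_real y) = of_real q * bessel_J n (\<i> * of_real y)"
proof -
  define a where "a = nat \<bar>n\<bar>"
  have sq: "(\<i> * of_real y)\<^sup>2 = - complex_of_real (y\<^sup>2)" by (simp add: power_mult_distrib)
  obtain c0 where c0: "c0 > 0" "bessel_series a (- of_real (y\<^sup>2)) = of_real c0"
    by (rule bessel_series_pos[of "y\<^sup>2"]) auto
  obtain c1 where c1: "c1 > 0" "bessel_series (Suc a) (- of_real (y\<^sup>2)) = of_real c1"
    by (rule bessel_series_pos[of "y\<^sup>2"]) auto
  show "bessel_J n (\<i> * of_real y) \<noteq> 0"
    using assms c0 unfolding bessel_J_series sq a_def[symmetric] by (simp add: bessel_sign_nonzero)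
  define q where "q = real a + y\<^sup>2 / 2 * c1 / c0"
  have "q > real a" unfolding q_def using assms c0 c1 by simp
  moreover have "of_nat a * complex_of_real c0 - - complex_of_real (y\<^sup>2) / 2 * of_real c1 = of_real q * of_real c0"
    using c0 unfolding q_def by (simp add: field_simps)
  then have "\<i> * of_real y * bessel_J' n (\<i> * of_real y) = of_real q * bessel_J n (\<i> * of_real y)"
    unfolding bessel_J_series euler_bessel_J sq a_def[symmetric] c0 c1 by (simp add: mult_ac)
  ultimately show "\<exists>q::real. q > real_of_int \<bar>n\<bar> \<and>
      \<i> * of_real y * bessel_J' n (\<i> * of_real y) = of_real q * bessel_J n (\<i> * of_real y)"
    unfolding a_def by auto
qed

section \<open>The function L and its zeros\<close>

text \<open>This is \<open>z L(z)\<close>, which extends to an entire function, with the derivative of the quotient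
  carried out.\<close>

definition L_entire :: "nat \<Rightarrow> int \<Rightarrow> complex \<Rightarrow> complex" where
  "L_entire m n z = of_nat m * bessel_J n z * bessel_J (n - int m) z
     - (z * bessel_J' n z * bessel_J (n - int m) z + bessel_J n z * (z * bessel_J' (n - int m) z))"

lemma L_fun_eq:
  assumes "z \<noteq> 0"
  shows "z * L_fun m n z = L_entire m n z"
proof -
  let ?J = "bessel_J n" and ?K = "bessel_J (n - int m)"
  have "((\<lambda>w. ?J w * ?K w / w ^ m) has_field_derivative
      ((bessel_J' n z * ?K z + bessel_J' (n - int m) z * ?J z) * z ^ m
        - ?J z * ?K z * (of_nat m * z ^ (m - 1))) / (z ^ m * z ^ m)) (at z)"
    using assms by (intro DERIV_divide DERIV_mult DERIV_bessel_J) (auto intro!: derivative_eq_intros)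
  then have "L_fun m n z = - (z ^ m) * (((bessel_J' n z * ?K z + bessel_J' (n - int m) z * ?J z) * z ^ m
        - ?J z * ?K z * (of_nat m * z ^ (m - 1))) / (z ^ m * z ^ m))"
    unfolding L_fun_def by (simp add: DERIV_imp_deriv)
  also have "\<dots> = - ((bessel_J' n z * ?K z + bessel_J' (n - int m) z * ?J z)
        - ?J z * ?K z * (of_nat m * z ^ (m - 1) / z ^ m))"
    using assms by (simp add: field_simps)
  also have "of_nat m * z ^ (m - 1) / z ^ m = of_nat m / z"
    using assms by (cases m) auto
  finally have "L_fun m n z = - ((bessel_J' n z * ?K z + bessel_J' (n - int m) z * ?J z)
        - ?J z * ?K z * (of_nat m / z))" .
  then have "z * L_fun m n z = - z * (bessel_J' n z * ?K z + bessel_J' (n - int m) z * ?J z)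
        + ?J z * ?K z * (z * (of_nat m / z))"
    by (simp only:) (simp add: algebra_simps)
  also have "z * (of_nat m / z) = of_nat m" using assms by simp
  finally show ?thesis
    by (simp add: L_entire_def algebra_simps)
qed

lemma Z_set_iff: "l \<in> Z_set m n \<longleftrightarrow> l \<noteq> 0 \<and> L_entire m n l = 0"
  unfolding Z_set_def using L_fun_eq[of l m n] by auto

lemma holomorphic_L_entire: "L_entire m n holomorphic_on UNIV"
  unfolding L_entire_def[abs_def]
  by (intro holomorphic_intros holomorphic_bessel_J holomorphic_deriv[of _ UNIV]) auto

text \<open>On the imaginary axis the two logarithmic derivatives exceed \<open>|n|\<close> and \<open>|n - m|\<close>, so by the triangle
  inequality their sum exceeds \<open>m\<close>.\<close>

lemma L_entire_imaginary:
  assumes "y \<noteq> 0"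
  shows "L_entire m n (\<i> * of_real y) \<noteq> 0"
proof -
  let ?z = "\<i> * complex_of_real y" and ?k = "n - int m"
  obtain q where q: "q > real_of_int \<bar>n\<bar>" "?z * bessel_J' n ?z = of_real q * bessel_J n ?z"
    using bessel_J_imaginary(2)[OF assms] by blast
  obtain q' where q': "q' > real_of_int \<bar>?k\<bar>" "?z * bessel_J' ?k ?z = of_real q' * bessel_J ?k ?z"
    using bessel_J_imaginary(2)[OF assms] by blast
  have "L_entire m n ?z = of_real (real m - (q + q')) * (bessel_J n ?z * bessel_J ?k ?z)"
    unfolding L_entire_def q q' by (simp add: algebra_simps)
  moreover have "real m - (q + q') \<noteq> 0" using q(1) q'(1) by linarith
  ultimately show ?thesis
    using bessel_J_imaginary(1)[OF assms] by (simp del: of_real_diff of_real_add)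
qed

lemma discrete_Z_set: "discrete (Z_set m n)"
proof (rule discreteI)
  fix l assume l: "l \<in> Z_set m n"
  have "L_entire m n (\<i> * of_real 1) \<noteq> 0" by (rule L_entire_imaginary) simp
  with l obtain r where r: "r > 0" "\<And>z. z \<in> ball l r - {l} \<Longrightarrow> L_entire m n z \<noteq> 0"
    unfolding Z_set_iff
    by (metis isolated_zeros[OF holomorphic_L_entire open_UNIV connected_UNIV] UNIV_I)
  show "l isolated_in Z_set m n"
  proof (rule isolated_inI[OF l])
    show "open (ball l r)" by simp
    show "ball l r \<inter> Z_set m n = {l}" using r l by (force simp: Z_set_iff)
  qed
qed


section \<open>Lommel integrals and transmission across the unit circle\<close>

definition lommel :: "int \<Rightarrow> complex \<Rightarrow> complex \<Rightarrow> complex" where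
  "lommel n l l' = integral {0..1} (\<lambda>r. of_real r * bessel_J n (l * of_real r) * bessel_J n (l' * of_real r))"

lemma continuous_on_bessel_J [continuous_intros]:
  "continuous_on A f \<Longrightarrow> continuous_on A (\<lambda>x. bessel_J n (f x))"
  by (rule continuous_on_compose2[OF holomorphic_on_imp_continuous_on[OF holomorphic_bessel_J]]) auto

lemma continuous_on_bessel_J' [continuous_intros]:
  "continuous_on A f \<Longrightarrow> continuous_on A (\<lambda>x. bessel_J' n (f x))"
  by (rule continuous_on_compose2[OF holomorphic_on_imp_continuous_on
        [OF holomorphic_deriv[OF holomorphic_bessel_J open_UNIV]]]) auto

lemma DERIV_bessel_J_scaled:
  "((\<lambda>z. bessel_J n (l * z)) has_field_derivative l * bessel_J' n (l * z)) (at z)"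
  using DERIV_chain2[OF DERIV_bessel_J DERIV_cmult[OF DERIV_ident, of l z]]
  by (simp add: mult.commute)

lemma bessel_equation_scaled:
  assumes "l \<noteq> 0" "z \<noteq> 0"
  shows "((\<lambda>z. l * z * bessel_J' n (l * z)) has_field_derivative
          (of_int n ^ 2 - (l * z)\<^sup>2) / z * bessel_J n (l * z)) (at z)"
proof -
  have "l * z \<noteq> 0" using assms by simp
  from DERIV_chain2[OF bessel_equation[OF this] DERIV_cmult[OF DERIV_ident]]
  have "((\<lambda>z. l * z * bessel_J' n (l * z)) has_field_derivative
      (of_int n ^ 2 - (l * z)\<^sup>2) / (l * z) * bessel_J n (l * z) * (l * 1)) (at z)" .
  moreover have "(of_int n ^ 2 - (l * z)\<^sup>2) / (l * z) * bessel_J n (l * z) * (l * 1)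
      = (of_int n ^ 2 - (l * z)\<^sup>2) / z * bessel_J n (l * z)"
    using assms by simp
  ultimately show ?thesis by (simp only:)
qed

lemma has_integral_lommel:
  "((\<lambda>r. of_real r * bessel_J n (l * of_real r) * bessel_J n (l' * of_real r)) has_integral lommel n l l') {0..1}"
  unfolding lommel_def
  by (intro integrable_integral integrable_continuous_interval continuous_intros)

text \<open>Lommel's first integral: Green's identity for the two solutions \<open>J\<^sub>n(\<lambda> r)\<close> and \<open>J\<^sub>n(\<lambda>' r)\<close>; the
  terms with \<open>n\<^sup>2\<close> cancel and the boundary term at \<open>r = 0\<close> vanishes.\<close>

lemma lommel_difference:
  assumes "l \<noteq> 0" "l' \<noteq> 0"
  shows "(l\<^sup>2 - l'\<^sup>2) * lommel n l l' =
     bessel_J n l * (l' * bessel_J' n l') - l * bessel_J' n l * bessel_J n l'"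
proof -
  define W where "W z = bessel_J n (l * z) * (l' * z * bessel_J' n (l' * z))
      - l * z * bessel_J' n (l * z) * bessel_J n (l' * z)" for z
  have "((\<lambda>r. (l\<^sup>2 - l'\<^sup>2) * (of_real r * bessel_J n (l * of_real r) * bessel_J n (l' * of_real r)))
      has_integral W (of_real 1) - W (of_real 0)) {0..1}"
  proof (rule fundamental_theorem_of_calculus_interior)
    show "continuous_on {0..1} (\<lambda>r. W (complex_of_real r))"
      unfolding W_def by (intro continuous_intros)
    fix r :: real assume r: "r \<in> {0<..<1}"
    define z where "z = complex_of_real r"
    have z: "z \<noteq> 0" using r by (simp add: z_def)
    have "(W has_field_derivative
        (l * bessel_J' n (l * z) * (l' * z * bessel_J' n (l' * z))
          + (of_int n ^ 2 - (l' * z)\<^sup>2) / z * bessel_J n (l' * z) * bessel_J n (l * z))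
       - ((of_int n ^ 2 - (l * z)\<^sup>2) / z * bessel_J n (l * z) * bessel_J n (l' * z)
          + l' * bessel_J' n (l' * z) * (l * z * bessel_J' n (l * z)))) (at z)"
      unfolding W_def
      by (intro DERIV_diff DERIV_mult DERIV_bessel_J_scaled bessel_equation_scaled assms z)
    also have "(l * bessel_J' n (l * z) * (l' * z * bessel_J' n (l' * z))
          + (of_int n ^ 2 - (l' * z)\<^sup>2) / z * bessel_J n (l' * z) * bessel_J n (l * z))
       - ((of_int n ^ 2 - (l * z)\<^sup>2) / z * bessel_J n (l * z) * bessel_J n (l' * z)
          + l' * bessel_J' n (l' * z) * (l * z * bessel_J' n (l * z)))
      = (l\<^sup>2 - l'\<^sup>2) * (z * bessel_J n (l * z) * bessel_J n (l' * z))"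
      using z by (simp add: field_simps power2_eq_square)
    finally show "((\<lambda>r. W (of_real r)) has_vector_derivative
        (l\<^sup>2 - l'\<^sup>2) * (of_real r * bessel_J n (l * of_real r) * bessel_J n (l' * of_real r))) (at r)"
      unfolding z_def by (rule has_vector_derivative_real_field)
  qed simp
  moreover have "((\<lambda>r. (l\<^sup>2 - l'\<^sup>2) * (of_real r * bessel_J n (l * of_real r) * bessel_J n (l' * of_real r)))
      has_integral (l\<^sup>2 - l'\<^sup>2) * lommel n l l') {0..1}"
    by (intro has_integral_mult_right has_integral_lommel)
  ultimately show ?thesis
    by (auto dest: has_integral_unique simp: W_def)
qed

text \<open>Lommel's second integral.  The antiderivative is the energy
  \<open>(x J')\<^sup>2 + (x\<^sup>2 - n\<^sup>2) J\<^sup>2\<close>, whose derivative is \<open>2 x J\<^sup>2\<close> by Bessel's equation.\<close>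

lemma lommel_diagonal:
  assumes "l \<noteq> 0"
  shows "2 * lommel n l l = (bessel_J' n l)\<^sup>2 + (1 - of_int n ^ 2 / l\<^sup>2) * (bessel_J n l)\<^sup>2"
proof -
  define W where "W z = (l * z * bessel_J' n (l * z))\<^sup>2
      + ((l * z)\<^sup>2 - of_int n ^ 2) * (bessel_J n (l * z))\<^sup>2" for z
  have "((\<lambda>r. 2 * l\<^sup>2 * (of_real r * bessel_J n (l * of_real r) * bessel_J n (l * of_real r)))
      has_integral W (of_real 1) - W (of_real 0)) {0..1}"
  proof (rule fundamental_theorem_of_calculus_interior)
    show "continuous_on {0..1} (\<lambda>r. W (complex_of_real r))"
      unfolding W_def by (intro continuous_intros)
    fix r :: real assume r: "r \<in> {0<..<1}"
    define z where "z = complex_of_real r"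
    have z: "z \<noteq> 0" using r by (simp add: z_def)
    have sq: "((\<lambda>z. (l * z)\<^sup>2 - of_int n ^ 2) has_field_derivative 2 * l\<^sup>2 * z) (at z)"
      by (auto intro!: derivative_eq_intros simp: power2_eq_square)
    have pw: "((\<lambda>z. (f z)\<^sup>2) has_field_derivative 2 * f z * D) (at z)"
      if "(f has_field_derivative D) (at z)" for f :: "complex \<Rightarrow> complex" and D
      using that by (auto intro!: derivative_eq_intros)
    have "(W has_field_derivative
        2 * (l * z * bessel_J' n (l * z)) * ((of_int n ^ 2 - (l * z)\<^sup>2) / z * bessel_J n (l * z))
        + (2 * l\<^sup>2 * z * (bessel_J n (l * z))\<^sup>2
          + 2 * bessel_J n (l * z) * (l * bessel_J' n (l * z)) * ((l * z)\<^sup>2 - of_int n ^ 2))) (at z)"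
      unfolding W_def
      by (intro DERIV_add DERIV_mult sq pw DERIV_bessel_J_scaled bessel_equation_scaled assms z)
    also have "2 * (l * z * bessel_J' n (l * z)) * ((of_int n ^ 2 - (l * z)\<^sup>2) / z * bessel_J n (l * z))
        + (2 * l\<^sup>2 * z * (bessel_J n (l * z))\<^sup>2
          + 2 * bessel_J n (l * z) * (l * bessel_J' n (l * z)) * ((l * z)\<^sup>2 - of_int n ^ 2))
      = 2 * l\<^sup>2 * (z * bessel_J n (l * z) * bessel_J n (l * z))"
      using z by (simp add: field_simps power2_eq_square)
    finally show "((\<lambda>r. W (of_real r)) has_vector_derivative
        2 * l\<^sup>2 * (of_real r * bessel_J n (l * of_real r) * bessel_J n (l * of_real r))) (at r)"
      unfolding z_def by (rule has_vector_derivative_real_field)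
  qed simp
  moreover have "((\<lambda>r. 2 * l\<^sup>2 * (of_real r * bessel_J n (l * of_real r) * bessel_J n (l * of_real r)))
      has_integral 2 * l\<^sup>2 * lommel n l l) {0..1}"
    by (intro has_integral_mult_right has_integral_lommel)
  moreover have "W 0 = 0"
    by (auto simp: W_def bessel_J_series)
  ultimately have "2 * l\<^sup>2 * lommel n l l = W 1"
    by (auto dest: has_integral_unique)
  then show ?thesis
    using assms by (simp add: W_def field_simps power2_eq_square)
qed

lemma bessel_J_nonzero_near_0:
  assumes "l \<noteq> 0"
  obtains r where "0 < r" "r < 1" "bessel_J n (l * of_real r) \<noteq> 0"
proof -
  let ?a = "nat \<bar>n\<bar>"
  have "((\<lambda>r. bessel_series ?a ((l * of_real r)\<^sup>2)) \<longlongrightarrow> bessel_series ?a 0) (at_right (0::real))"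
    by (rule isCont_tendsto_compose[OF DERIV_isCont[OF DERIV_bessel_series]])
       (auto intro!: tendsto_eq_intros)
  then have "eventually (\<lambda>r. bessel_series ?a ((l * of_real r)\<^sup>2) \<noteq> 0) (at_right 0)"
    by (rule tendsto_imp_eventually_ne) (simp add: bessel_series_0)
  moreover have "eventually (\<lambda>r::real. r \<in> {0<..<1}) (at_right 0)"
    by (rule eventually_at_right_real) simp
  ultimately have "eventually (\<lambda>r. r \<in> {0<..<1} \<and> bessel_series ?a ((l * of_real r)\<^sup>2) \<noteq> 0) (at_right 0)"
    by eventually_elim simp
  then obtain r where "r \<in> {0<..<1}" "bessel_series ?a ((l * of_real r)\<^sup>2) \<noteq> 0"
    using eventually_happens'[of "at_right (0::real)"] by auto
  then show ?thesis
    using that[of r] assms by (simp add: bessel_J_series bessel_sign_nonzero)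
qed

lemma lommel_cnj_pos:
  assumes "l \<noteq> 0"
  obtains p where "p > 0" "lommel n l (cnj l) = of_real p"
proof -
  define f where "f r = r * (norm (bessel_J n (l * of_real r)))\<^sup>2" for r :: real
  have cont: "continuous_on {0..1} f"
    unfolding f_def by (intro continuous_intros)
  have fi: "(f has_integral integral {0..1} f) {0..1}"
    by (intro integrable_integral integrable_continuous_interval cont)
  have "of_real r * bessel_J n (l * of_real r) * bessel_J n (cnj l * of_real r) = of_real (f r)" for r
    using cnj_bessel_J[of n "l * of_real r"]
    by (simp add: f_def complex_norm_square mult.assoc del: of_real_power)
  then have "lommel n l (cnj l) = of_real (integral {0..1} f)"
    unfolding lommel_def by (simp add: integral_unique[OF has_integral_of_real[OF fi]])
  moreover have "integral {0..1} f > 0"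
  proof -
    obtain r where r: "0 < r" "r < 1" "bessel_J n (l * of_real r) \<noteq> 0"
      using bessel_J_nonzero_near_0[OF assms] .
    have "f r \<noteq> 0" using r by (simp add: f_def)
    moreover have "integral {0..1} f \<ge> 0"
      by (rule integral_nonneg) (auto simp: f_def intro!: integrable_continuous_interval cont[unfolded f_def[abs_def]])
    moreover have "integral {0..1} f = 0 \<longleftrightarrow> (\<forall>r\<in>{0..1}. f r = 0)"
      by (rule integral_eq_0_iff[OF cont]) (auto simp: f_def)
    ultimately show ?thesis
      using r by fastforce
  qed
  ultimately show ?thesis using that by blast
qed

text \<open>The conditions under which \<open>a J\<^sub>n(\<lambda> r)\<close> inside and \<open>b r\<^sup>m J\<^sub>n\<^sub>-\<^sub>m(\<lambda> / r)\<close> outside agree at \<open>r = 1\<close>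
  together with their radial derivatives.\<close>

definition transmission :: "nat \<Rightarrow> int \<Rightarrow> complex \<Rightarrow> complex \<Rightarrow> complex \<Rightarrow> bool" where
  "transmission m n l a b \<longleftrightarrow>
     a * bessel_J n l = b * bessel_J (n - int m) l \<and>
     a * (l * bessel_J' n l) + b * (l * bessel_J' (n - int m) l) = of_nat m * (a * bessel_J n l)"

text \<open>The boundary terms of the inner disc are \<open>u p' - p u'\<close> with \<open>u = a J\<^sub>n(\<lambda>)\<close> and \<open>p = a \<lambda> J\<^sub>n'(\<lambda>)\<close>.
  Transmission replaces \<open>(u, p)\<close> by \<open>(u, m u - p)\<close> on the outer disc, which reverses the sign of
  this alternating form.\<close>

lemma transmission_orthogonal:
  assumes "l \<noteq> 0" "l' \<noteq> 0" "l\<^sup>2 \<noteq> l'\<^sup>2"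
    and "transmission m n l a b" "transmission m n l' a' b'"
  shows "a * a' * lommel n l l' + b * b' * lommel (n - int m) l l' = 0"
proof -
  let ?k = "n - int m"
  define u p where "u = a * bessel_J n l" and "p = a * (l * bessel_J' n l)"
  define u' p' where "u' = a' * bessel_J n l'" and "p' = a' * (l' * bessel_J' n l')"
  have k: "b * bessel_J ?k l = u" "b * (l * bessel_J' ?k l) = of_nat m * u - p"
    "b' * bessel_J ?k l' = u'" "b' * (l' * bessel_J' ?k l') = of_nat m * u' - p'"
    using assms(4,5) by (simp_all add: transmission_def u_def p_def u'_def p'_def algebra_simps)
  have "(l\<^sup>2 - l'\<^sup>2) * (a * a' * lommel n l l' + b * b' * lommel ?k l l')
      = a * a' * ((l\<^sup>2 - l'\<^sup>2) * lommel n l l') + b * b' * ((l\<^sup>2 - l'\<^sup>2) * lommel ?k l l')"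
    by (simp add: algebra_simps)
  also have "\<dots> = (u * p' - p * u') + ((b * bessel_J ?k l) * (b' * (l' * bessel_J' ?k l'))
      - (b * (l * bessel_J' ?k l)) * (b' * bessel_J ?k l'))"
    unfolding lommel_difference[OF assms(1,2)] u_def p_def u'_def p'_def by (simp add: algebra_simps)
  also have "\<dots> = 0" unfolding k by (simp add: algebra_simps)
  finally show ?thesis using assms(3) by simp
qed

text \<open>At any zero of \<open>L\<close> the amplitudes \<open>a = J\<^sub>n\<^sub>-\<^sub>m(\<lambda>)\<close> and \<open>b = J\<^sub>n(\<lambda>)\<close> satisfy the transmission
  conditions, as do their conjugates at the conjugate of \<open>\<lambda>\<close>.  If \<open>\<lambda>\<^sup>2\<close> were not real, orthogonality would
  force \<open>a = b = 0\<close>, and then the first Lommel integral would vanish as well.\<close>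

lemma Z_set_real: "Z_set m n \<subseteq> \<real> - {0}"
proof
  fix l assume l: "l \<in> Z_set m n"
  let ?k = "n - int m"
  have l0: "l \<noteq> 0" and L: "L_entire m n l = 0" using l by (auto simp: Z_set_iff)
  have "l\<^sup>2 = (cnj l)\<^sup>2"
  proof (rule ccontr)
    assume ne: "l\<^sup>2 \<noteq> (cnj l)\<^sup>2"
    let ?a = "bessel_J ?k l" and ?b = "bessel_J n l"
    have tr: "transmission m n l ?a ?b"
      using L by (simp add: transmission_def L_entire_def algebra_simps)
    have "transmission m n (cnj l) (cnj ?a) (cnj ?b)"
      using arg_cong[OF L, of cnj]
      by (simp add: transmission_def L_entire_def algebra_simps cnj_bessel_J cnj_bessel_J')
    from transmission_orthogonal[OF l0 _ ne tr this] l0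
    have 0: "?a * cnj ?a * lommel n l (cnj l) + ?b * cnj ?b * lommel ?k l (cnj l) = 0" by simp
    obtain p where p: "p > 0" "lommel n l (cnj l) = of_real p" using lommel_cnj_pos[OF l0] .
    obtain q where q: "q > 0" "lommel ?k l (cnj l) = of_real q" using lommel_cnj_pos[OF l0] .
    have "of_real ((norm ?a)\<^sup>2 * p + (norm ?b)\<^sup>2 * q) = (0 :: complex)"
      using 0 unfolding p q by (simp add: complex_norm_square del: of_real_power)
    then have "(norm ?a)\<^sup>2 * p + (norm ?b)\<^sup>2 * q = 0" by (simp only: of_real_eq_0_iff)
    then have "?b = 0"
      using p(1) q(1) by (smt (verit) zero_le_mult_iff zero_le_power2 mult_eq_0_iff norm_eq_zero power_eq_0_iff)
    then have "(l\<^sup>2 - (cnj l)\<^sup>2) * of_real p = 0"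
      using lommel_difference[OF l0, of "cnj l" n] l0 p(2) by (simp add: cnj_bessel_J)
    then show False using ne p(1) by simp
  qed
  then have "l = cnj l \<or> l = - cnj l" by (simp add: power2_eq_iff)
  moreover have "l \<noteq> - cnj l"
  proof
    assume "l = - cnj l"
    then have "Re l = 0" by (metis Re_divide_of_nat add.inverse_inverse cnj.simps(1) minus_complex.simps(1) uminus_complex.simps(1) neg_equal_zero)
    then have i: "l = \<i> * of_real (Im l)" by (simp add: complex_eq_iff)
    with l0 have "Im l \<noteq> 0" by (metis mult_zero_right of_real_0)
    from L_entire_imaginary[OF this] i L show False by metis
  qed
  ultimately show "l \<in> \<real> - {0}" using l0 by (metis Diff_iff Reals_cnj_iff singletonD)
qed

section \<open>Oscillation of Bessel functions\<close>

text \<open>Read \<open>p\<close> as \<open>x y'\<close>.  As long as \<open>y\<close> is positive, \<open>p\<close> decreases.  If \<open>p\<close> ever becomes negative,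
  \<open>y\<close> falls below a constant minus a multiple of the logarithm, so it becomes negative.  If \<open>p\<close> stays
  nonnegative, \<open>y\<close> is bounded below by a positive constant, so \<open>p\<close> decreases at least linearly and
  becomes negative after all.\<close>

lemma bessel_ode_not_positive:
  fixes y p :: "real \<Rightarrow> real"
  assumes y: "\<And>x. x > 0 \<Longrightarrow> (y has_real_derivative p x / x) (at x)"
    and p: "\<And>x. x > 0 \<Longrightarrow> (p has_real_derivative (c - x\<^sup>2) / x * y x) (at x)"
    and b: "b \<ge> \<bar>c\<bar> + 1" and pos: "\<And>x. x \<ge> b \<Longrightarrow> y x > 0"
  shows False
proof -
  have coeff: "(c - x\<^sup>2) / x \<le> - 1" if "x \<ge> b" for x
  proof -
    have "x * (x - 1) \<ge> 1 * (x - 1)" using that b by (intro mult_right_mono) auto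
    then have "c - x\<^sup>2 \<le> - x" using that b by (simp add: power2_eq_square algebra_simps)
    moreover have "x > 0" using that b by linarith
    ultimately show ?thesis by (simp add: pos_divide_le_eq)
  qed
  have p': "(c - x\<^sup>2) / x * y x \<le> - y x" if "x \<ge> b" for x
    using mult_right_mono[OF coeff[OF that], of "y x"] pos[OF that] by simp
  have p_nonneg: "p x0 \<ge> 0" if x0: "x0 \<ge> b" for x0
  proof (rule ccontr)
    define d where "d = - p x0"
    assume "\<not> p x0 \<ge> 0"
    then have d: "d > 0" by (simp add: d_def)
    have pd: "p x \<le> - d" if "x \<ge> x0" for x
    proof -
      have "p x \<le> p x0"
      proof (rule DERIV_nonpos_imp_nonincreasing[OF that])
        fix t assume "x0 \<le> t" "t \<le> x"
        then have t: "t \<ge> b" "t > 0" using x0 b by auto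
        show "\<exists>q. (p has_real_derivative q) (at t) \<and> q \<le> 0"
          using p[OF t(2)] p'[OF t(1)] pos[OF t(1)] by (intro exI[of _ "(c - t\<^sup>2) / t * y t"]) auto
      qed
      then show ?thesis by (simp add: d_def)
    qed
    \<comment> \<open>The point where the bound \<open>y x0 - d ln (x / x0)\<close> for \<open>y\<close> reaches \<open>0\<close>.\<close>
    define x1 where "x1 = x0 * exp (y x0 / d)"
    have x0_pos: "x0 > 0" using x0 b by auto
    have "x1 \<ge> x0" using x0_pos pos[OF x0] d by (simp add: x1_def)
    have "y x1 + d * ln x1 \<le> y x0 + d * ln x0"
    proof (rule DERIV_nonpos_imp_nonincreasing[OF \<open>x1 \<ge> x0\<close>])
      fix t assume "x0 \<le> t" "t \<le> x1"
      then have t: "t \<ge> x0" "t > 0" using x0_pos by auto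
      have "((\<lambda>x. y x + d * ln x) has_real_derivative p t / t + d * (1 / t)) (at t)"
        using t by (intro DERIV_add DERIV_cmult y) (auto intro!: derivative_eq_intros)
      moreover have "p t / t + d * (1 / t) \<le> 0"
        using pd[OF t(1)] t(2) by (simp add: divide_le_0_iff flip: add_divide_distrib)
      ultimately show "\<exists>q. ((\<lambda>x. y x + d * ln x) has_real_derivative q) (at t) \<and> q \<le> 0" by blast
    qed
    moreover have "ln x1 = ln x0 + y x0 / d" using x0_pos by (simp add: x1_def ln_mult)
    then have "d * ln x1 = d * ln x0 + y x0" using d by (simp add: distrib_left)
    ultimately have "y x1 \<le> 0" by simp
    then show False using pos[of x1] \<open>x1 \<ge> x0\<close> x0 by simp
  qed
  have y_ge: "y x \<ge> y b" if "x \<ge> b" for x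
  proof (rule DERIV_nonneg_imp_nondecreasing[OF that])
    fix t assume "b \<le> t" "t \<le> x"
    then have "t > 0" "p t \<ge> 0" using b p_nonneg by auto
    then show "\<exists>q. (y has_real_derivative q) (at t) \<and> 0 \<le> q"
      using y by (intro exI[of _ "p t / t"]) auto
  qed
  define e where "e = y b"
  have e: "e > 0" using pos[of b] by (simp add: e_def)
  \<comment> \<open>Past \<open>b + p b / e\<close> the linear bound for \<open>p\<close> is negative.\<close>
  define x1 where "x1 = b + p b / e + 1"
  have x1: "x1 \<ge> b" using e p_nonneg[of b] by (simp add: x1_def)
  have "p x1 + e * x1 \<le> p b + e * b"
  proof (rule DERIV_nonpos_imp_nonincreasing[OF x1])
    fix t assume "b \<le> t" "t \<le> x1"
    then have t: "t \<ge> b" "t > 0" using b by auto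
    have "((\<lambda>x. p x + e * x) has_real_derivative (c - t\<^sup>2) / t * y t + e * 1) (at t)"
      using t by (intro DERIV_add DERIV_cmult p DERIV_ident)
    moreover have "(c - t\<^sup>2) / t * y t + e * 1 \<le> 0"
      using p'[OF t(1)] y_ge[OF t(1)] by (simp add: e_def)
    ultimately show "\<exists>q. ((\<lambda>x. p x + e * x) has_real_derivative q) (at t) \<and> q \<le> 0" by blast
  qed
  moreover have "e * x1 = e * b + p b + e" using e by (simp add: x1_def field_simps)
  ultimately have "p x1 < 0" using e by simp
  with p_nonneg[OF x1] show False by simp
qed

lemma bessel_ode_has_zero:
  fixes y p :: "real \<Rightarrow> real"
  assumes y: "\<And>x. x > 0 \<Longrightarrow> (y has_real_derivative p x / x) (at x)"
    and p: "\<And>x. x > 0 \<Longrightarrow> (p has_real_derivative (c - x\<^sup>2) / x * y x) (at x)"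
  obtains x where "x \<ge> a" "y x = 0"
proof -
  define b where "b = max a (\<bar>c\<bar> + 1)"
  have b: "b \<ge> a" "b \<ge> \<bar>c\<bar> + 1" "b > 0" by (auto simp: b_def)
  have "\<exists>x\<ge>b. y x = 0"
  proof (rule ccontr)
    assume no: "\<not> (\<exists>x\<ge>b. y x = 0)"
    have cont: "isCont y x" if "x \<ge> b" for x
      using y[of x] that b by (auto intro: DERIV_isCont)
    have same: "y x > 0 \<longleftrightarrow> y b > 0" if "x \<ge> b" for x
    proof (rule ccontr)
      assume "\<not> (y x > 0 \<longleftrightarrow> y b > 0)"
      then have "y b \<le> 0 \<and> 0 \<le> y x \<or> y x \<le> 0 \<and> 0 \<le> y b" by auto
      then have "\<exists>t. b \<le> t \<and> t \<le> x \<and> y t = 0"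
        using IVT[of y b 0 x] IVT2[of y x 0 b] that cont by blast
      then show False using no by auto
    qed
    show False
    proof (cases "y b > 0")
      case True
      then show False using bessel_ode_not_positive[OF y p b(2)] same by blast
    next
      case False
      have "- y x > 0" if "x \<ge> b" for x
        using same[OF that] False no that by (metis less_le neg_0_less_iff_less not_less)
      moreover have "((\<lambda>x. - y x) has_real_derivative (- p x) / x) (at x)" if "x > 0" for x
        using DERIV_minus[OF y[OF that]] by simp
      moreover have "((\<lambda>x. - p x) has_real_derivative (c - x\<^sup>2) / x * (- y x)) (at x)" if "x > 0" for x
        using DERIV_minus[OF p[OF that]] by simp
      ultimately show False
        using bessel_ode_not_positive[of "\<lambda>x. - y x" "\<lambda>x. - p x" c b] b(2) by blast
    qed
  qed
  then obtain x where "x \<ge> b" "y x = 0" by blast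
  then show ?thesis using that[of x] b(1) by simp
qed

lemma bessel_J_of_real: "bessel_J n (of_real x) = of_real (Re (bessel_J n (of_real x)))"
  using cnj_bessel_J[of n "of_real x"] by (simp add: complex_eq_iff)

lemma bessel_J'_of_real: "bessel_J' n (of_real x) = of_real (Re (bessel_J' n (of_real x)))"
  using cnj_bessel_J'[of n "of_real x"] by (simp add: complex_eq_iff)

lemma has_real_derivative_Re:
  assumes "(f has_field_derivative of_real D) (at (of_real x))"
  shows "((\<lambda>x. Re (f (of_real x))) has_real_derivative D) (at x)"
  using bounded_linear.has_vector_derivative[OF bounded_linear_Re has_vector_derivative_real_field[OF assms]]
  by (simp add: has_real_derivative_iff_has_vector_derivative)

lemma DERIV_Re_bessel_J:
  "((\<lambda>x. Re (bessel_J n (of_real x))) has_real_derivative Re (bessel_J' n (of_real x))) (at x)"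
  using DERIV_bessel_J[of n "of_real x"] bessel_J'_of_real by (intro has_real_derivative_Re) metis

lemma Re_bessel_J_has_zero:
  obtains x where "x \<ge> a" "Re (bessel_J n (of_real x)) = 0"
proof (rule bessel_ode_has_zero[of "\<lambda>x. Re (bessel_J n (of_real x))" "\<lambda>x. x * Re (bessel_J' n (of_real x))"])
  fix x :: real assume x: "x > 0"
  show "((\<lambda>x. Re (bessel_J n (of_real x))) has_real_derivative x * Re (bessel_J' n (of_real x)) / x) (at x)"
    using DERIV_Re_bessel_J[of n x] x by simp
  have "complex_of_real x \<noteq> 0" using x by simp
  from bessel_equation[OF this, of n]
  have "((\<lambda>z. z * bessel_J' n z) has_field_derivative
     of_real (((of_int n)\<^sup>2 - x\<^sup>2) / x * Re (bessel_J n (of_real x)))) (at (of_real x))"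
    by (subst (asm) bessel_J_of_real) simp
  from has_real_derivative_Re[OF this]
  show "((\<lambda>x. x * Re (bessel_J' n (of_real x))) has_real_derivative
     ((of_int n)\<^sup>2 - x\<^sup>2) / x * Re (bessel_J n (of_real x))) (at x)"
    by simp
qed (use that in blast)

text \<open>Between two zeros of \<open>J\<^sub>n\<close> lies a critical point of \<open>J\<^sub>n J\<^sub>n\<^sub>-\<^sub>m / x\<^sup>m\<close>, that is, a zero of \<open>L\<close>; and the
  zeros of \<open>J\<^sub>n\<close> are unbounded.\<close>

lemma infinite_Z_set: "infinite (Z_set m n)"
proof
  let ?k = "n - int m"
  define y where "y n x = Re (bessel_J n (of_real x))" for n x
  define y' where "y' n x = Re (bessel_J' n (of_real x))" for n x
  have J: "bessel_J n (of_real x) = of_real (y n x)" "bessel_J' n (of_real x) = of_real (y' n x)" for n x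
    unfolding y_def y'_def by (rule bessel_J_of_real, rule bessel_J'_of_real)
  have dy: "(y n has_real_derivative y' n x) (at x)" for n x
    unfolding y_def y'_def by (rule DERIV_Re_bessel_J)
  assume fin: "finite (Z_set m n)"
  then have "bdd_above (Re ` Z_set m n)" by (intro bdd_above_finite) simp
  then obtain M where M: "\<And>l. l \<in> Z_set m n \<Longrightarrow> Re l \<le> M" by (auto simp: bdd_above_def)
  obtain x1 where x1: "x1 \<ge> max M 1" "y n x1 = 0"
    unfolding y_def by (rule Re_bessel_J_has_zero)
  obtain x2 where x2: "x2 \<ge> x1 + 1" "y n x2 = 0"
    unfolding y_def by (rule Re_bessel_J_has_zero)
  define g where "g x = y n x * y ?k x / x ^ m" for x
  define N where "N x = (y' n x * y ?k x + y' ?k x * y n x) * x ^ m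
      - y n x * y ?k x * (real m * x ^ (m - 1))" for x
  have dg: "(g has_real_derivative N x / (x ^ m * x ^ m)) (at x)" if "x > 0" for x
    unfolding g_def N_def
    by (intro DERIV_divide DERIV_mult dy) (use that in \<open>auto intro!: derivative_eq_intros\<close>)
  have "\<exists>t. x1 < t \<and> t < x2 \<and> DERIV g t :> 0"
  proof (rule Rolle)
    show "continuous_on {x1..x2} g"
      using x1(1) by (intro continuous_at_imp_continuous_on ballI DERIV_isCont[OF dg]) auto
    show "g differentiable (at x)" if "x1 < x" "x < x2" for x
      using dg[of x] that x1(1) by (auto simp: real_differentiable_def)
  qed (use x1 x2 in \<open>auto simp: g_def\<close>)
  then obtain t where t: "x1 < t" "t < x2" "DERIV g t :> 0" by blast
  have t0: "t > 0" using t(1) x1(1) by simp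
  have "N t / (t ^ m * t ^ m) = 0" using DERIV_unique[OF dg[OF t0] t(3)] .
  then have "0 = t * N t" using t0 by simp
  also have "t * N t = (t * (y' n t * y ?k t + y' ?k t * y n t)) * t ^ m
      - y n t * y ?k t * (real m * (t * t ^ (m - 1)))"
    unfolding N_def by (simp only: right_diff_distrib mult_ac)
  also have "real m * (t * t ^ (m - 1)) = real m * t ^ m" by (cases m) simp_all
  also have "(t * (y' n t * y ?k t + y' ?k t * y n t)) * t ^ m - y n t * y ?k t * (real m * t ^ m)
      = (t * (y' n t * y ?k t + y' ?k t * y n t) - real m * (y n t * y ?k t)) * t ^ m"
    by (simp add: algebra_simps)
  finally have "(t * (y' n t * y ?k t + y' ?k t * y n t) - real m * (y n t * y ?k t)) * t ^ m = 0" ..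
  then have "t * (y' n t * y ?k t + y' ?k t * y n t) - real m * (y n t * y ?k t) = 0"
    using t0 by simp
  then have "complex_of_real (real m * y n t * y ?k t - (t * y' n t * y ?k t + y n t * (t * y' ?k t))) = 0"
    by (subst of_real_eq_0_iff) (simp add: algebra_simps)
  then have "L_entire m n (of_real t) = 0" by (simp add: L_entire_def J)
  then have "of_real t \<in> Z_set m n" using t0 by (simp add: Z_set_iff)
  from M[OF this] show False using t(1) x1(1) by simp
qed

section \<open>Rotations and polar coordinates for planar Lebesgue measure\<close>

text \<open>A linear isometry preserves Lebesgue measure because its image measure is again invariant under
  translations and gives the unit ball \<open>B\<close> the same volume: for two translation-invariant measures,
  Tonelli's theorem yields \<open>\<mu>(A) \<nu>(B) = \<nu>(A) \<mu>(B)\<close> when \<open>B\<close> is symmetric.\<close>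

lemma distr_lborel_linear_isometry:
  fixes f :: "'a::euclidean_space \<Rightarrow> 'a"
  assumes f: "linear f" and norm: "\<And>x. norm (f x) = norm x"
  shows "distr lborel borel f = lborel"
proof (rule measure_eqI)
  show "sets (distr lborel borel f) = sets lborel" by simp
  have [measurable]: "f \<in> borel \<rightarrow>\<^sub>M borel"
    by (rule borel_measurable_continuous_onI[OF linear_continuous_on])
       (simp add: f linear_conv_bounded_linear[symmetric])
  have "inj f" using norm linear_injective_0[OF f] by (metis norm_eq_zero)
  then have surj: "surj f" by (intro linear_injective_imp_surjective f) simp_all
  have shift: "(\<integral>\<^sup>+x. g (c + x) \<partial>lborel) = (\<integral>\<^sup>+x. g x \<partial>lborel)"
    if "g \<in> borel_measurable borel" for c :: 'a and g :: "'a \<Rightarrow> ennreal"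
    using that nn_integral_distr[of "(+) c" lborel borel g] by (simp add: lborel_distr_plus)
  fix A :: "'a set" assume "A \<in> sets (distr lborel borel f)"
  then have A [measurable]: "A \<in> sets borel" by simp
  define B where "B = ball (0 :: 'a) 1"
  have B [measurable]: "B \<in> sets borel" by (simp add: B_def)
  define v where "v = emeasure lborel B"
  have fA: "emeasure (distr lborel borel f) A = (\<integral>\<^sup>+x. indicator A (f x) \<partial>lborel)"
    by (simp add: nn_integral_distr flip: nn_integral_indicator)
  have inner: "(\<integral>\<^sup>+x. indicator A (f x) \<partial>lborel) = (\<integral>\<^sup>+x. indicator A (f x + y) \<partial>lborel)" for y
  proof -
    obtain c where c: "y = f c" using surj by auto
    show ?thesis
      using shift[of "\<lambda>x. indicator A (f x)" c] by (simp add: c linear_add[OF f] add.commute)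
  qed
  have outer: "(\<integral>\<^sup>+x. indicator B (w - f x) \<partial>lborel) = v" for w
  proof -
    obtain c where c: "w = f c" using surj by auto
    have "norm (f c - f x) = dist c x" for x
      by (simp add: dist_norm norm flip: linear_diff[OF f])
    then have "(\<integral>\<^sup>+x. indicator B (w - f x) \<partial>lborel) = (\<integral>\<^sup>+x. indicator (ball c 1) x \<partial>lborel)"
      by (intro nn_integral_cong) (auto simp: c B_def indicator_def)
    also have "\<dots> = v" by (simp add: v_def B_def emeasure_ball)
    finally show ?thesis .
  qed
  have "v * emeasure (distr lborel borel f) A = (\<integral>\<^sup>+y. indicator B y * (\<integral>\<^sup>+x. indicator A (f x) \<partial>lborel) \<partial>lborel)"
    unfolding fA by (simp add: nn_integral_multc v_def)
  also have "\<dots> = (\<integral>\<^sup>+y. (\<integral>\<^sup>+x. indicator B y * indicator A (f x + y) \<partial>lborel) \<partial>lborel)"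
  proof (rule nn_integral_cong)
    fix y
    show "indicator B y * (\<integral>\<^sup>+x. indicator A (f x) \<partial>lborel)
        = (\<integral>\<^sup>+x. indicator B y * indicator A (f x + y) \<partial>lborel :: ennreal)"
      unfolding inner[of y] by (simp add: nn_integral_cmult)
  qed
  also have "\<dots> = (\<integral>\<^sup>+x. (\<integral>\<^sup>+y. indicator B y * indicator A (f x + y) \<partial>lborel) \<partial>lborel)"
    by (rule lborel_pair.Fubini') measurable
  also have "\<dots> = (\<integral>\<^sup>+x. (\<integral>\<^sup>+w. indicator B (w - f x) * indicator A w \<partial>lborel) \<partial>lborel)"
  proof (rule nn_integral_cong)
    fix x
    show "(\<integral>\<^sup>+y. indicator B y * indicator A (f x + y) \<partial>lborel)
        = (\<integral>\<^sup>+w. indicator B (w - f x) * indicator A w \<partial>lborel :: ennreal)"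
      using shift[of "\<lambda>w. indicator B (w - f x) * indicator A w" "f x"] by simp
  qed
  also have "\<dots> = (\<integral>\<^sup>+w. (\<integral>\<^sup>+x. indicator B (w - f x) * indicator A w \<partial>lborel) \<partial>lborel)"
    by (rule lborel_pair.Fubini') measurable
  also have "\<dots> = (\<integral>\<^sup>+w. v * indicator A w \<partial>lborel)"
    by (simp add: nn_integral_multc outer)
  also have "\<dots> = v * emeasure lborel A"
    by (simp add: nn_integral_cmult)
  finally have "v * emeasure (distr lborel borel f) A = v * emeasure lborel A" .
  moreover have "v \<noteq> 0" "v \<noteq> \<infinity>"
  proof -
    have "unit_ball_vol (real DIM('a)) \<noteq> 0"
      by (rule less_imp_neq[symmetric], rule unit_ball_vol_pos) simp
    moreover have "v = ennreal (unit_ball_vol (real DIM('a)))"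
      by (simp add: v_def B_def emeasure_ball)
    ultimately show "v \<noteq> 0" "v \<noteq> \<infinity>" by (simp_all add: ennreal_eq_0_iff order_le_less not_less)
  qed
  ultimately show "emeasure (distr lborel borel f) A = emeasure lborel A"
    by (simp add: ennreal_mult_cancel_left)
qed

text \<open>Polar coordinates for radial functions, obtained from the areas of discs alone.\<close>

lemma distr_lborel_norm:
  "distr (lborel :: complex measure) borel norm
     = density lborel (\<lambda>r. ennreal (2 * pi * r) * indicator {0..} r)" (is "?M = ?N")
proof (rule measure_eqI_generator_eq)
  let ?E = "range (\<lambda>a::real. {..a})"
  show "Int_stable ?E" by (auto simp: Int_stable_def)
  show "?E \<subseteq> Pow UNIV" by simp
  show "sets ?M = sigma_sets UNIV ?E" by (simp add: borel_eq_atMost)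
  show "sets ?N = sigma_sets UNIV ?E" by (simp add: borel_eq_atMost)
  have M: "emeasure ?M {..a} = ennreal (if a \<ge> 0 then pi * a\<^sup>2 else 0)" for a
  proof -
    have "norm -` {..a} = cball (0::complex) a" by auto
    then have "emeasure ?M {..a} = emeasure lborel (cball (0::complex) a)"
      by (simp add: emeasure_distr)
    then show ?thesis
      by (simp add: emeasure_cball unit_ball_vol_2 cball_empty)
  qed
  fix X assume "X \<in> ?E"
  then obtain a where X: "X = {..a}" by auto
  have "emeasure ?N {..a} = (\<integral>\<^sup>+r. ennreal (2 * pi * r) * indicator {0..a} r \<partial>lborel)"
    by (subst emeasure_density) (auto intro!: nn_integral_cong simp: indicator_def)
  also have "\<dots> = ennreal (if a \<ge> 0 then pi * a\<^sup>2 else 0)"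
  proof (cases "a \<ge> 0")
    case True
    have "(\<integral>\<^sup>+r. ennreal (2 * pi * r) * indicator {0..a} r \<partial>lborel) = ennreal (pi * a\<^sup>2 - pi * 0\<^sup>2)"
      by (rule nn_integral_FTC_Icc) (use True in \<open>auto intro!: derivative_eq_intros\<close>)
    then show ?thesis using True by simp
  qed simp
  finally show "emeasure ?M X = emeasure ?N X" by (simp only: X M)
next
  show "range (\<lambda>i::nat. {..real i}) \<subseteq> range (\<lambda>a::real. {..a})" by auto
  show "(\<Union>i::nat. {..real i}) = UNIV" using real_arch_simple by fastforce
  show "emeasure ?M {..real i} \<noteq> \<infinity>" for i
  proof -
    have "norm -` {..real i} = cball (0::complex) i" by auto
    then show ?thesis by (simp add: emeasure_distr emeasure_cball)
  qed
qed

section \<open>The canonical measure on the sphere\<close>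

lemma distr_omega_inf_norm:
  "distr omega_inf borel norm = density lborel (\<lambda>r. ennreal (2 * r / max 1 r ^ 4) * indicator {0..} r)"
    (is "?M = ?N")
proof (rule measure_eqI)
  fix A assume "A \<in> sets ?M"
  then have A [measurable]: "A \<in> sets borel" by simp
  let ?h = "\<lambda>r. ennreal (1 / pi * (1 / max 1 r ^ 4)) * indicator A r"
  have norm_meas [measurable]: "(norm :: complex \<Rightarrow> real) \<in> omega_inf \<rightarrow>\<^sub>M borel"
    unfolding omega_inf_def by simp
  have "emeasure ?M A = (\<integral>\<^sup>+z. indicator A (norm z) \<partial>omega_inf)"
    using nn_integral_distr[OF norm_meas, of "indicator A"] by simp
  also have "\<dots> = (\<integral>\<^sup>+z. ?h (norm z) \<partial>(lborel :: complex measure))"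
    unfolding omega_inf_def by (subst nn_integral_density) auto
  also have "\<dots> = (\<integral>\<^sup>+r. ?h r \<partial>distr (lborel :: complex measure) borel norm)"
    by (subst nn_integral_distr) auto
  also have "\<dots> = (\<integral>\<^sup>+r. ennreal (2 * pi * r) * indicator {0..} r * ?h r \<partial>lborel)"
    unfolding distr_lborel_norm by (subst nn_integral_density) auto
  also have "\<dots> = emeasure ?N A"
    by (subst emeasure_density)
       (auto simp: indicator_def ennreal_mult[symmetric] intro!: nn_integral_cong arg_cong[where f = ennreal])
  finally show "emeasure ?M A = emeasure ?N A" .
qed simp

lemma space_omega_inf [simp]: "space omega_inf = UNIV"
  and sets_omega_inf [simp, measurable_cong]: "sets omega_inf = sets borel"
  by (simp_all add: omega_inf_def)

lemma finite_measure_omega_inf: "finite_measure omega_inf"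
proof (rule finite_measureI)
  have "emeasure omega_inf (space omega_inf) = emeasure (distr omega_inf borel norm) UNIV"
    by (simp add: emeasure_distr)
  also have "\<dots> = (\<integral>\<^sup>+r. ennreal (2 * r / max 1 r ^ 4) * indicator {0..} r \<partial>lborel)"
    unfolding distr_omega_inf_norm by (simp add: emeasure_density)
  also have "\<dots> \<le> (\<integral>\<^sup>+r. ennreal (2 * r) * indicator {0..1} r + ennreal (2 / r ^ 3) * indicator {1..} r \<partial>lborel)"
    by (intro nn_integral_mono) (auto simp: indicator_def max_def power_eq_if divide_simps)
  also have "\<dots> = (\<integral>\<^sup>+r. ennreal (2 * r) * indicator {0..1} r \<partial>lborel)
      + (\<integral>\<^sup>+r. ennreal (2 / r ^ 3) * indicator {1..} r \<partial>lborel)"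
    by (intro nn_integral_add) auto
  also have "(\<integral>\<^sup>+r. ennreal (2 * r) * indicator {0..1} r \<partial>lborel) = ennreal (1\<^sup>2 - 0\<^sup>2)"
    by (rule nn_integral_FTC_Icc) (auto intro!: derivative_eq_intros)
  also have "(\<integral>\<^sup>+r. ennreal (2 / r ^ 3) * indicator {1..} r \<partial>lborel) = ennreal (0 - (- (1 / 1\<^sup>2)))"
  proof (rule nn_integral_FTC_atLeast[where F = "\<lambda>r. - (1 / r\<^sup>2)"])
    show "((\<lambda>r::real. - (1 / r\<^sup>2)) \<longlongrightarrow> 0) at_top"
      using tendsto_minus[OF tendsto_inverse_0_at_top[OF filterlim_pow_at_top[of 2 "\<lambda>x. x::real"]]]
      by (simp add: inverse_eq_divide filterlim_ident)
  qed (auto intro!: derivative_eq_intros simp: divide_simps power2_eq_square power3_eq_cube)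
  finally show "emeasure omega_inf (space omega_inf) \<noteq> \<infinity>"
    by (auto simp: top_unique)
qed

lemma integrable_omega_inf_bounded:
  fixes f :: "complex \<Rightarrow> 'b :: {banach, second_countable_topology}"
  assumes "f \<in> borel_measurable borel" "\<And>z. norm (f z) \<le> C"
  shows "integrable omega_inf f"
  using assms by (intro finite_measure.integrable_const_bound[OF finite_measure_omega_inf, of _ C]) auto

lemma AE_omega_inf: "AE z in omega_inf. z \<noteq> 0 \<and> norm z \<noteq> 1"
proof -
  have "AE r in distr omega_inf borel norm. r \<noteq> 0 \<and> r \<noteq> 1"
    unfolding distr_omega_inf_norm using AE_lborel_singleton[of "0::real"] AE_lborel_singleton[of "1::real"]
    by (subst AE_density) auto
  then have "AE z in omega_inf. norm z \<noteq> 0 \<and> norm z \<noteq> 1"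
    by (rule AE_distrD[rotated]) simp
  then show ?thesis by simp
qed

text \<open>Rotating by \<open>\<pi> / k\<close> changes the sign of the integrand and preserves the measure.\<close>

lemma omega_inf_rotation_zero:
  fixes f :: "complex \<Rightarrow> complex" and k :: int
  assumes f [measurable]: "f \<in> borel_measurable borel"
    and k: "k \<noteq> 0" and hom: "\<And>u z. norm u = 1 \<Longrightarrow> z \<noteq> 0 \<Longrightarrow> f (u * z) = u powi k * f z"
  shows "(\<integral>z. f z \<partial>omega_inf) = 0"
proof -
  \<comment> \<open>The rotation with \<open>u powi k = - 1\<close>.\<close>
  define u where "u = cis (pi / of_int k)"
  have u: "norm u = 1" by (simp add: u_def)
  have uk: "u powi k = - 1"
    using k by (simp add: u_def cis_power_int)
  have rot: "distr lborel borel (\<lambda>z. u * z) = lborel"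
    by (rule distr_lborel_linear_isometry) (auto simp: u norm_mult intro: bounded_linear.linear bounded_linear_mult_right)
  let ?w = "\<lambda>z. 1 / pi * (1 / max 1 (norm (z :: complex)) ^ 4)"
  have om: "(\<integral>z. f z \<partial>omega_inf) = (\<integral>z. ?w z *\<^sub>R f z \<partial>lborel)"
    unfolding omega_inf_def by (subst integral_density) auto
  also have "\<dots> = (\<integral>z. ?w z *\<^sub>R f z \<partial>distr lborel borel (\<lambda>z. u * z))"
    unfolding rot ..
  also have "\<dots> = (\<integral>z. ?w (u * z) *\<^sub>R f (u * z) \<partial>lborel)"
    by (subst integral_distr) auto
  also have "\<dots> = (\<integral>z. - (?w z *\<^sub>R f z) \<partial>lborel)"
  proof (rule integral_cong_AE)
    show "AE z in lborel. ?w (u * z) *\<^sub>R f (u * z) = - (?w z *\<^sub>R f z)"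
      using AE_lborel_singleton[of "0::complex"]
      by eventually_elim (simp add: hom u uk norm_mult)
  qed auto
  also have "\<dots> = - (\<integral>z. f z \<partial>omega_inf)" unfolding om by simp
  finally show ?thesis by simp
qed

text \<open>The substitution \<open>r \<mapsto> 1 / r\<close> turns the density \<open>2 / r\<^sup>3\<close> on the outer region into the density
  \<open>2 r\<close> of the unit disc; it is carried out on the antiderivative of \<open>r Q(r)\<close>.\<close>

lemma integral_omega_inf_radial:
  fixes P Q :: "real \<Rightarrow> complex"
  assumes P: "continuous_on UNIV P" and Q: "continuous_on UNIV Q"
  shows "(\<integral>z. (if norm z < 1 then P (norm z) else Q (1 / norm z)) \<partial>omega_inf)
     = 2 * integral {0..1} (\<lambda>r. of_real r * P r) + 2 * integral {0..1} (\<lambda>r. of_real r * Q r)"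
proof -
  have [measurable]: "P \<in> borel_measurable borel" "Q \<in> borel_measurable borel"
    using P Q by (auto intro: borel_measurable_continuous_onI)
  define g where "g r = (if r < 1 then P r else Q (1 / r))" for r
  have g [measurable]: "g \<in> borel_measurable borel" unfolding g_def by measurable
  obtain C where C: "\<And>r. 0 \<le> r \<Longrightarrow> r \<le> 1 \<Longrightarrow> norm (P r) \<le> C" "\<And>r. 0 \<le> r \<Longrightarrow> r \<le> 1 \<Longrightarrow> norm (Q r) \<le> C"
  proof -
    have "compact (P ` {0..1} \<union> Q ` {0..1})"
      using P Q by (intro compact_Un compact_continuous_image) (auto intro: continuous_on_subset)
    then obtain C where "\<forall>x\<in>P ` {0..1} \<union> Q ` {0..1}. norm x \<le> C"
      by (metis compact_imp_bounded bounded_iff)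
    then show ?thesis using that[of C] by auto
  qed
  have gC: "norm (g r) \<le> C" if "r \<ge> 0" for r using C that by (auto simp: g_def)
  have int: "integrable omega_inf (\<lambda>z. g (norm z))"
    by (rule integrable_omega_inf_bounded[of _ C]) (auto simp: gC)
  let ?w = "\<lambda>r::real. 2 * r / max 1 r ^ 4 * indicator {0..} r"
  have w: "ennreal (2 * r / max 1 r ^ 4) * indicator {0..} r = ennreal (?w r)" for r
    by (auto simp: indicator_def)
  have "integrable (distr omega_inf borel norm) g"
    using int by (subst integrable_distr_eq) auto
  then have int2: "integrable lborel (\<lambda>r. ?w r *\<^sub>R g r)"
    unfolding distr_omega_inf_norm w by (subst (asm) integrable_density) (auto simp: indicator_def)
  let ?A = "\<lambda>r. indicator {0..1} r *\<^sub>R (2 * of_real r * P r)"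
  let ?B = "\<lambda>r. indicator {1<..} r *\<^sub>R (2 / of_real r ^ 3 * Q (1 / r))"
  have split: "AE r in lborel. ?w r *\<^sub>R g r = ?A r + ?B r"
    using AE_lborel_singleton[of "1::real"]
    by eventually_elim (auto simp: indicator_def g_def max_def scaleR_conv_of_real power_eq_if)
  have intA: "integrable lborel ?A"
  proof -
    have "continuous_on {0..1} (\<lambda>r. 2 * of_real r * P r)"
      by (intro continuous_intros continuous_on_subset[OF P]) auto
    from borel_integrable_atLeastAtMost'[OF this] show ?thesis
      by (simp add: set_integrable_def)
  qed
  have "AE r in lborel. ?w r *\<^sub>R g r - ?A r = ?B r"
    using split by eventually_elim (simp only: add_diff_cancel_left')
  with Bochner_Integration.integrable_diff[OF int2 intA] have intB: "integrable lborel ?B"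
    by (subst (asm) integrable_cong_AE) auto
  have "(\<integral>z. g (norm z) \<partial>omega_inf) = (\<integral>r. g r \<partial>distr omega_inf borel norm)"
    by (subst integral_distr) auto
  also have "\<dots> = (\<integral>r. ?w r *\<^sub>R g r \<partial>lborel)"
    unfolding distr_omega_inf_norm w by (subst integral_density) (auto simp: indicator_def)
  also have "\<dots> = (\<integral>r. ?A r + ?B r \<partial>lborel)"
    by (rule integral_cong_AE[OF _ _ split]) auto
  also have "\<dots> = (\<integral>r. ?A r \<partial>lborel) + (\<integral>r. ?B r \<partial>lborel)"
    by (rule Bochner_Integration.integral_add[OF intA intB])
  also have "(\<integral>r. ?A r \<partial>lborel) = integral {0..1} (\<lambda>r. 2 * of_real r * P r)"
    using set_borel_integral_eq_integral(2)[of "{0..1}" "\<lambda>r. 2 * of_real r * P r"] intA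
    by (simp add: set_lebesgue_integral_def set_integrable_def)
  also have "\<dots> = 2 * integral {0..1} (\<lambda>r. of_real r * P r)"
    by (subst integral_mult_right[symmetric]) (simp add: mult.assoc)
  also have "(\<integral>r. ?B r \<partial>lborel) = 2 * integral {0..1} (\<lambda>r. of_real r * Q r)"
  proof -
    define K where "K x = integral {0..x} (\<lambda>r. of_real r * Q r)" for x :: real
    have cQ: "continuous_on {0..1} (\<lambda>r. of_real r * Q r)"
      by (intro continuous_intros continuous_on_subset[OF Q]) auto
    have cK: "continuous_on {0..1} K"
      unfolding K_def by (intro indefinite_integral_continuous_1 integrable_continuous_interval cQ)
    have dK: "(K has_vector_derivative of_real x * Q x) (at x)" if "0 < x" "x < 1" for x
      using integral_has_vector_derivative[OF cQ, of x] that
      by (simp add: K_def[abs_def] at_within_Icc_at)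
    have "(LBINT r=ereal 1..\<infinity>. 2 / of_real r ^ 3 * Q (1 / r)) = - 2 * K 0 - (- 2 * K 1)"
    proof (rule interval_integral_FTC_integrable[where F = "\<lambda>r. - 2 * K (1 / r)"])
      show "((\<lambda>r. - 2 * K (1 / r)) has_vector_derivative 2 / of_real r ^ 3 * Q (1 / r)) (at r)"
        if "ereal 1 < ereal r" "ereal r < \<infinity>" for r
      proof -
        have r: "r > 1" using that by simp
        have "((\<lambda>r. 1 / r) has_vector_derivative - (1 / r\<^sup>2)) (at r)"
          unfolding has_real_derivative_iff_has_vector_derivative[symmetric]
          using r by (auto intro!: derivative_eq_intros simp: power2_eq_square divide_simps)
        from vector_diff_chain_at[OF this dK] r
        have "(K \<circ> (\<lambda>r. 1 / r) has_vector_derivative - (1 / r\<^sup>2) *\<^sub>R (of_real (1 / r) * Q (1 / r))) (at r)"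
          by simp
        then have "((\<lambda>r. - 2 * K (1 / r)) has_vector_derivative
            - 2 * (- (1 / r\<^sup>2) *\<^sub>R (of_real (1 / r) * Q (1 / r)))) (at r)"
          unfolding o_def by (intro has_vector_derivative_mult_right)
        moreover have "- 2 * (- (1 / r\<^sup>2) *\<^sub>R (of_real (1 / r) * Q (1 / r))) = 2 / of_real r ^ 3 * Q (1 / r)"
          by (simp add: scaleR_conv_of_real power2_eq_square power3_eq_cube)
        ultimately show ?thesis by (simp only:)
      qed
      show "isCont (\<lambda>r. 2 / of_real r ^ 3 * Q (1 / r)) r" if "ereal 1 < ereal r" "ereal r < \<infinity>" for r
      proof -
        have r: "r \<noteq> 0" using that by auto
        have "isCont Q (1 / r)" using Q by (simp add: continuous_on_eq_continuous_at)
        moreover have "isCont (\<lambda>r. 1 / r) r" using r by (intro continuous_intros)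
        ultimately have "isCont (\<lambda>r. Q (1 / r)) r"
          using isCont_o2[of r "\<lambda>r. 1 / r" Q] by simp
        then show ?thesis using r by (intro continuous_intros) simp_all
      qed
      show "set_integrable lborel (einterval (ereal 1) \<infinity>) (\<lambda>r. 2 / of_real r ^ 3 * Q (1 / r))"
        using intB by (simp add: set_integrable_def)
      have lim: "((\<lambda>r. - 2 * K (1 / r)) \<longlongrightarrow> - 2 * K l) F"
        if "((\<lambda>r. 1 / r) \<longlongrightarrow> l) F" "l \<in> {0..1}" "eventually (\<lambda>r. r \<ge> 1) F" for l and F :: "real filter"
        using that(3)
        by (intro tendsto_mult_left continuous_on_tendsto_compose[OF cK that(1,2)])
           (auto elim!: eventually_mono)
      show "(((\<lambda>r. - 2 * K (1 / r)) \<circ> real_of_ereal) \<longlongrightarrow> - 2 * K 1) (at_right (ereal 1))"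
        unfolding ereal_tendsto_simps
        by (rule lim) (auto intro!: tendsto_eq_intros simp: eventually_at_filter)
      show "(((\<lambda>r. - 2 * K (1 / r)) \<circ> real_of_ereal) \<longlongrightarrow> - 2 * K 0) (at_left \<infinity>)"
        unfolding ereal_tendsto_simps
        by (rule lim) (auto intro: eventually_ge_at_top
            tendsto_inverse_0_at_top[OF filterlim_ident, unfolded inverse_eq_divide])
    qed simp
    then show ?thesis
      by (simp add: interval_integral_to_infinity_eq set_lebesgue_integral_def K_def)
  qed
  finally show ?thesis by (simp add: g_def)
qed

section \<open>Smooth functions built from the coordinate and its conjugate\<close>

text \<open>A class of functions closed under directional derivatives, which therefore consists of smooth
  functions; it contains the affine representatives of the approximating sections.\<close>

inductive smooth_expr :: "(complex \<Rightarrow> complex) \<Rightarrow> bool" where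
  const: "smooth_expr (\<lambda>z. c)"
| ident: "smooth_expr (\<lambda>z. z)"
| cnj: "smooth_expr cnj"
| add: "smooth_expr f \<Longrightarrow> smooth_expr g \<Longrightarrow> smooth_expr (\<lambda>z. f z + g z)"
| mult: "smooth_expr f \<Longrightarrow> smooth_expr g \<Longrightarrow> smooth_expr (\<lambda>z. f z * g z)"
| inverse: "smooth_expr f \<Longrightarrow> (\<And>z. f z \<noteq> 0) \<Longrightarrow> smooth_expr (\<lambda>z. inverse (f z))"

lemma smooth_expr_power: "smooth_expr f \<Longrightarrow> smooth_expr (\<lambda>z. f z ^ n)"
  by (induction n) (auto intro: smooth_expr.intros)

lemma smooth_expr_sum: "(\<And>i. i \<in> I \<Longrightarrow> smooth_expr (f i)) \<Longrightarrow> smooth_expr (\<lambda>z. \<Sum>i\<in>I. f i z)"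
  by (induction I rule: infinite_finite_induct) (auto intro: smooth_expr.intros)

lemma smooth_expr_derivative:
  assumes "smooth_expr f"
  shows "\<exists>f'. (\<forall>z. (f has_derivative f' z) (at z)) \<and> (\<forall>v. smooth_expr (\<lambda>z. f' z v))"
  using assms
proof induction
  case (const c)
  then show ?case by (intro exI[of _ "\<lambda>z v. 0"]) (auto intro: smooth_expr.const)
next
  case ident
  then show ?case by (intro exI[of _ "\<lambda>z v. v"]) (auto intro: smooth_expr.const)
next
  case cnj
  show ?case
    by (intro exI[of _ "\<lambda>z v. cnj v"])
       (auto intro: smooth_expr.const bounded_linear.has_derivative[OF bounded_linear_cnj has_derivative_ident])
next
  case (add f g)
  then obtain f' g' where
    "\<And>z. (f has_derivative f' z) (at z)" "\<And>v. smooth_expr (\<lambda>z. f' z v)"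
    "\<And>z. (g has_derivative g' z) (at z)" "\<And>v. smooth_expr (\<lambda>z. g' z v)" by blast
  then show ?case
    by (intro exI[of _ "\<lambda>z v. f' z v + g' z v"]) (auto intro: smooth_expr.add has_derivative_add)
next
  case (mult f g)
  then obtain f' g' where
    "\<And>z. (f has_derivative f' z) (at z)" "\<And>v. smooth_expr (\<lambda>z. f' z v)"
    "\<And>z. (g has_derivative g' z) (at z)" "\<And>v. smooth_expr (\<lambda>z. g' z v)" by blast
  with mult.hyps show ?case
    by (intro exI[of _ "\<lambda>z v. f z * g' z v + f' z v * g z"])
       (auto intro!: smooth_expr.add smooth_expr.mult has_derivative_mult)
next
  case (inverse f)
  then obtain f' where f': "\<And>z. (f has_derivative f' z) (at z)" "\<And>v. smooth_expr (\<lambda>z. f' z v)" by blast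
  have "((\<lambda>z. inverse (f z)) has_derivative (\<lambda>v. - 1 * (inverse (f z) * f' z v * inverse (f z)))) (at z)" for z
    using Deriv.has_derivative_inverse[OF inverse.hyps(2) f'(1)[of z]] by simp
  moreover have "smooth_expr (\<lambda>z. - 1 * (inverse (f z) * f' z v * inverse (f z)))" for v
    by (intro smooth_expr.mult smooth_expr.const smooth_expr.inverse f' inverse.hyps)
  ultimately show ?case
    by (intro exI[of _ "\<lambda>z v. - 1 * (inverse (f z) * f' z v * inverse (f z))"]) blast
qed

lemma C_infinity_smooth_expr:
  assumes "smooth_expr f"
  shows "C_infinity f"
proof -
  have "C_k k f" if "smooth_expr f" for k f
    using that
  proof (induction k arbitrary: f)
    case 0
    then obtain f' where "\<And>z. (f has_derivative f' z) (at z)" using smooth_expr_derivative by blast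
    then show ?case
      by (auto simp: continuous_on_eq_continuous_at intro: has_derivative_continuous)
  next
    case (Suc k)
    then obtain f' where f': "\<And>z. (f has_derivative f' z) (at z)" "\<And>v. smooth_expr (\<lambda>z. f' z v)"
      using smooth_expr_derivative by blast
    have "frechet_derivative f (at z) = f' z" for z
      using frechet_derivative_at[OF f'(1)] by simp
    then show ?case
      using f' Suc.IH by (auto simp: differentiable_def)
  qed
  with assms show ?thesis by (simp add: C_infinity_def)
qed

section \<open>Approximation by smooth sections\<close>

text \<open>The monomial of angular frequency \<open>n\<close> and radial degree \<open>|n| + 2 j\<close> in the coordinate and its
  conjugate is \<open>z\<close> to the first exponent times the conjugate of \<open>z\<close> to the second.\<close>

definition hol_exp :: "int \<Rightarrow> nat \<Rightarrow> nat" where "hol_exp n j = nat n + j"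
definition antihol_exp :: "int \<Rightarrow> nat \<Rightarrow> nat" where "antihol_exp n j = nat (- n) + j"

lemma exp_sum: "hol_exp n j + antihol_exp n j = nat \<bar>n\<bar> + 2 * j"
  by (auto simp: hol_exp_def antihol_exp_def)

text \<open>Homogeneous form of the \<open>N\<close>-th partial sum of \<open>\<Sum>j. c j z\<^sup>h z\<^sup>*\<^sup>a\<close> (exponents as above), divided by
  \<open>1 + |z|\<^sup>2\<^sup>k\<close>.  The choice \<open>k = |n| + 2 N\<close>, the highest degree that occurs, keeps all exponents
  nonnegative in both charts and is large enough to make the quotient decay for \<open>|z| > 1\<close>.\<close>

definition approx_section :: "nat \<Rightarrow> int \<Rightarrow> (nat \<Rightarrow> complex) \<Rightarrow> nat \<Rightarrow> section_rep" where
  "approx_section m n c N x0 x1 =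
     (let k = nat \<bar>n\<bar> + 2 * N in
       (\<Sum>j\<le>N. c j * (x0 ^ (m + k - hol_exp n j) * x1 ^ hol_exp n j
            * (cnj x0 ^ (k - antihol_exp n j) * cnj x1 ^ antihol_exp n j)))
       * inverse (x0 ^ k * cnj x0 ^ k + x1 ^ k * cnj x1 ^ k))"

lemma smooth_expr_approx_section:
  assumes "smooth_expr f" "smooth_expr (\<lambda>z. cnj (f z))" "smooth_expr g" "smooth_expr (\<lambda>z. cnj (g z))"
    and "\<And>k z. f z ^ k * cnj (f z) ^ k + g z ^ k * cnj (g z) ^ k \<noteq> 0"
  shows "smooth_expr (\<lambda>z. approx_section m n c N (f z) (g z))"
  unfolding approx_section_def Let_def
  by (intro smooth_expr.mult smooth_expr.inverse smooth_expr.add smooth_expr_sum smooth_expr_power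
      smooth_expr.const assms)

lemma power_times_cnj_power: "z ^ k * cnj z ^ k = complex_of_real (norm z ^ (2 * k))"
proof -
  have "z ^ k * cnj z ^ k = (z * cnj z) ^ k" by (rule power_mult_distrib[symmetric])
  also have "\<dots> = complex_of_real ((norm z)\<^sup>2) ^ k" by (simp only: complex_norm_square)
  finally show ?thesis by (simp only: power_mult of_real_power)
qed

lemma one_plus_norm_power_nonzero: "1 + z ^ k * cnj z ^ k \<noteq> 0"
proof -
  have "1 + z ^ k * cnj z ^ k = of_real (1 + norm z ^ (2 * k))"
    unfolding power_times_cnj_power by simp
  moreover have "1 + norm z ^ (2 * k) > 0" by (simp add: add_pos_nonneg)
  ultimately show ?thesis by (simp only: of_real_eq_0_iff)
qed

lemma is_section_approx_section: "is_section m (approx_section m n c N)"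
  unfolding is_section_def
proof (intro allI impI)
  fix a x0 x1 :: complex assume a: "a \<noteq> 0"
  define k where "k = nat \<bar>n\<bar> + 2 * N"
  have "c j * ((a * x0) ^ (m + k - hol_exp n j) * (a * x1) ^ hol_exp n j
            * (cnj (a * x0) ^ (k - antihol_exp n j) * cnj (a * x1) ^ antihol_exp n j))
      = (a ^ (m + k) * cnj a ^ k) * (c j * (x0 ^ (m + k - hol_exp n j) * x1 ^ hol_exp n j
            * (cnj x0 ^ (k - antihol_exp n j) * cnj x1 ^ antihol_exp n j)))" if "j \<le> N" for j
  proof -
    have "hol_exp n j \<le> m + k" "antihol_exp n j \<le> k"
      using exp_sum[of n j] that by (auto simp: k_def)
    then have "a ^ (m + k) = a ^ (m + k - hol_exp n j) * a ^ hol_exp n j"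
      "cnj a ^ k = cnj a ^ (k - antihol_exp n j) * cnj a ^ antihol_exp n j"
      by (simp_all flip: power_add)
    then show ?thesis by (simp only: power_mult_distrib complex_cnj_mult mult_ac)
  qed
  then have num: "(\<Sum>j\<le>N. c j * ((a * x0) ^ (m + k - hol_exp n j) * (a * x1) ^ hol_exp n j
            * (cnj (a * x0) ^ (k - antihol_exp n j) * cnj (a * x1) ^ antihol_exp n j)))
      = (a ^ (m + k) * cnj a ^ k) * (\<Sum>j\<le>N. c j * (x0 ^ (m + k - hol_exp n j) * x1 ^ hol_exp n j
            * (cnj x0 ^ (k - antihol_exp n j) * cnj x1 ^ antihol_exp n j)))"
    unfolding sum_distrib_left by (intro sum.cong refl) (simp only: atMost_iff)
  have den: "(a * x0) ^ k * cnj (a * x0) ^ k + (a * x1) ^ k * cnj (a * x1) ^ k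
      = (a ^ k * cnj a ^ k) * (x0 ^ k * cnj x0 ^ k + x1 ^ k * cnj x1 ^ k)"
    by (simp add: power_mult_distrib algebra_simps)
  have "(a ^ (m + k) * cnj a ^ k) * S * inverse ((a ^ k * cnj a ^ k) * D) = a ^ m * (S * inverse D)" for S D
    using a by (simp add: power_add field_simps)
  then show "approx_section m n c N (a * x0) (a * x1) = a ^ m * approx_section m n c N x0 x1"
    unfolding approx_section_def Let_def k_def[symmetric] num den by (simp only:)
qed

lemma approx_section_affine:
  "approx_section m n c N 1 z =
     (\<Sum>j\<le>N. c j * (z ^ hol_exp n j * cnj z ^ antihol_exp n j)) / of_real (1 + norm z ^ (2 * (nat \<bar>n\<bar> + 2 * N)))"
  unfolding approx_section_def Let_def power_times_cnj_power by (simp add: divide_inverse)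

lemma norm_approx_section_affine_le:
  assumes "\<And>j. j \<le> N \<Longrightarrow> norm z ^ (nat \<bar>n\<bar> + 2 * j) \<le> B * (1 + norm z ^ (2 * (nat \<bar>n\<bar> + 2 * N)))"
    and c: "summable (\<lambda>j. norm (c j))" and B: "B \<ge> 0"
  shows "norm (approx_section m n c N 1 z) \<le> (\<Sum>j. norm (c j)) * B"
proof -
  let ?D = "1 + norm z ^ (2 * (nat \<bar>n\<bar> + 2 * N))"
  have D: "?D > 0" by (smt (verit) zero_le_power norm_ge_zero)
  have "norm (\<Sum>j\<le>N. c j * (z ^ hol_exp n j * cnj z ^ antihol_exp n j))
      \<le> (\<Sum>j\<le>N. norm (c j) * (B * ?D))"
  proof (rule sum_norm_le)
    fix j assume "j \<in> {..N}"
    then have "norm z ^ (nat \<bar>n\<bar> + 2 * j) \<le> B * ?D" by (intro assms) simp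
    then show "norm (c j * (z ^ hol_exp n j * cnj z ^ antihol_exp n j)) \<le> norm (c j) * (B * ?D)"
      unfolding norm_mult norm_power complex_mod_cnj power_add[symmetric] exp_sum
      by (rule mult_left_mono) simp
  qed
  also have "\<dots> \<le> (\<Sum>j. norm (c j)) * (B * ?D)"
    unfolding sum_distrib_right[symmetric]
    using D B by (intro mult_right_mono sum_le_suminf c) auto
  finally have "norm (\<Sum>j\<le>N. c j * (z ^ hol_exp n j * cnj z ^ antihol_exp n j)) / ?D
      \<le> (\<Sum>j. norm (c j)) * B"
    using D by (simp add: divide_le_eq mult.assoc)
  moreover have "norm (approx_section m n c N 1 z)
      = norm (\<Sum>j\<le>N. c j * (z ^ hol_exp n j * cnj z ^ antihol_exp n j)) / ?D"
    unfolding approx_section_affine norm_divide norm_of_real using D by simp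
  ultimately show ?thesis by (simp only:)
qed

lemma norm_approx_section_affine_bound:
  assumes "summable (\<lambda>j. norm (c j))"
  shows "norm (approx_section m n c N 1 z) \<le> (\<Sum>j. norm (c j))"
proof -
  have "norm z ^ (nat \<bar>n\<bar> + 2 * j) \<le> 1 * (1 + norm z ^ (2 * (nat \<bar>n\<bar> + 2 * N)))" if "j \<le> N" for j
  proof (cases "norm z \<le> 1")
    case True
    then have "norm z ^ (nat \<bar>n\<bar> + 2 * j) \<le> 1" by (simp add: power_le_one)
    then show ?thesis by (smt (verit) zero_le_power norm_ge_zero)
  next
    case False
    then have "norm z ^ (nat \<bar>n\<bar> + 2 * j) \<le> norm z ^ (2 * (nat \<bar>n\<bar> + 2 * N))"
      using that by (intro power_increasing) auto
    then show ?thesis by simp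
  qed
  from norm_approx_section_affine_le[OF this assms] show ?thesis by simp
qed

lemma summable_monomials:
  assumes c: "summable (\<lambda>j. norm (c j))" and z: "norm z < 1"
  shows "summable (\<lambda>j. c j * (z ^ hol_exp n j * cnj z ^ antihol_exp n j))"
proof (rule summable_comparison_test'[OF c])
  fix j :: nat
  show "norm (c j * (z ^ hol_exp n j * cnj z ^ antihol_exp n j)) \<le> norm (c j)"
    using z by (auto simp: norm_mult norm_power simp flip: power_add intro!: mult_left_le power_le_one)
qed

lemma approx_section_tendsto_inside:
  assumes c: "summable (\<lambda>j. norm (c j))" and z: "norm z < 1"
  shows "(\<lambda>N. approx_section m n c N 1 z) \<longlonglongrightarrow> (\<Sum>j. c j * (z ^ hol_exp n j * cnj z ^ antihol_exp n j))"
proof -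
  from summable_LIMSEQ'[OF summable_monomials[OF assms]]
  have num: "(\<lambda>N. \<Sum>j\<le>N. c j * (z ^ hol_exp n j * cnj z ^ antihol_exp n j))
      \<longlonglongrightarrow> (\<Sum>j. c j * (z ^ hol_exp n j * cnj z ^ antihol_exp n j))" .
  have "(\<lambda>N. norm z ^ (2 * nat \<bar>n\<bar>) * (norm z ^ 4) ^ N) \<longlonglongrightarrow> norm z ^ (2 * nat \<bar>n\<bar>) * 0"
    using z by (intro tendsto_mult_left LIMSEQ_realpow_zero) (auto simp: power_less_one_iff)
  also have "(\<lambda>N. norm z ^ (2 * nat \<bar>n\<bar>) * (norm z ^ 4) ^ N) = (\<lambda>N. norm z ^ (2 * (nat \<bar>n\<bar> + 2 * N)))"
    by (simp add: fun_eq_iff flip: power_mult power_add)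
  finally have "(\<lambda>N. 1 + norm z ^ (2 * (nat \<bar>n\<bar> + 2 * N))) \<longlonglongrightarrow> 1 + norm z ^ (2 * nat \<bar>n\<bar>) * 0"
    by (intro tendsto_intros)
  then have den: "(\<lambda>N. complex_of_real (1 + norm z ^ (2 * (nat \<bar>n\<bar> + 2 * N)))) \<longlonglongrightarrow> of_real 1"
    by (intro tendsto_of_real) simp
  show ?thesis
    unfolding approx_section_affine using tendsto_divide[OF num den] by simp
qed

lemma approx_section_tendsto_outside:
  assumes c: "summable (\<lambda>j. norm (c j))" and z: "norm z > 1"
  shows "(\<lambda>N. approx_section m n c N 1 z) \<longlonglongrightarrow> 0"
proof (rule Lim_null_comparison)
  have "norm z ^ (nat \<bar>n\<bar> + 2 * j) \<le> (1 / norm z) ^ N * (1 + norm z ^ (2 * (nat \<bar>n\<bar> + 2 * N)))"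
    if "j \<le> N" for j N
  proof -
    have "norm z ^ N * norm z ^ (nat \<bar>n\<bar> + 2 * j) \<le> norm z ^ (2 * (nat \<bar>n\<bar> + 2 * N))"
      unfolding power_add[symmetric] using z that by (intro power_increasing) auto
    then have "norm z ^ N * norm z ^ (nat \<bar>n\<bar> + 2 * j) \<le> 1 + norm z ^ (2 * (nat \<bar>n\<bar> + 2 * N))"
      by simp
    moreover have "norm z ^ N > 0" using z by (intro zero_less_power) linarith
    ultimately show ?thesis
      unfolding power_one_over times_divide_eq_left mult_1 by (simp only: pos_le_divide_eq mult.commute)
  qed
  from norm_approx_section_affine_le[OF this c]
  show "eventually (\<lambda>N. norm (approx_section m n c N 1 z) \<le> (\<Sum>j. norm (c j)) * (1 / norm z) ^ N) sequentially"
    by (intro always_eventually) auto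
  show "(\<lambda>N. (\<Sum>j. norm (c j)) * (1 / norm z) ^ N) \<longlonglongrightarrow> 0"
    using z by (intro tendsto_mult_right_zero LIMSEQ_realpow_zero) (auto simp: divide_less_eq)
qed

text \<open>The two discs are approximated separately: the outer half is the inner half of the section with
  \<open>x\<^sub>0\<close> and \<open>x\<^sub>1\<close> exchanged.  Each approximant converges to its own half on one side of the circle and
  to \<open>0\<close> on the other, with uniformly bounded pointwise norm.\<close>

lemma H_spaceI:
  assumes sec: "is_section m s" and meas: "(\<lambda>z. s 1 z) \<in> borel_measurable borel"
    and c: "summable (\<lambda>j. norm (c j))" and d: "summable (\<lambda>j. norm (d j))"
    and inside: "\<And>z. z \<noteq> 0 \<Longrightarrow> norm z < 1 \<Longrightarrow> s 1 z = (\<Sum>j. c j * (z ^ hol_exp n j * cnj z ^ antihol_exp n j))"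
    and outside: "\<And>z. norm z > 1 \<Longrightarrow> s 1 z =
       z ^ m * (\<Sum>j. d j * ((1 / z) ^ hol_exp n' j * cnj (1 / z) ^ antihol_exp n' j))"
  shows "s \<in> H_space m"
proof -
  define t where "t N x0 x1 = approx_section m n c N x0 x1 + approx_section m n' d N x1 x0" for N x0 x1
  have chart: "approx_section m n' d N z 1 = z ^ m * approx_section m n' d N 1 (1 / z)" if "z \<noteq> 0" for N z
  proof -
    have "approx_section m n' d N (z * 1) (z * (1 / z)) = z ^ m * approx_section m n' d N 1 (1 / z)"
      using is_section_approx_section[of m n' d N, unfolded is_section_def, rule_format, of z 1 "1 / z"] that
      by simp
    then show ?thesis using that by simp
  qed
  have smooth: "t N \<in> smooth_sections m" for N
  proof -
    have "is_section m (t N)"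
      using is_section_approx_section[of m n c N] is_section_approx_section[of m n' d N]
      by (auto simp: is_section_def t_def algebra_simps)
    moreover have "C_infinity (\<lambda>z. t N 1 z)" "C_infinity (\<lambda>w. t N w 1)"
      unfolding t_def using one_plus_norm_power_nonzero
      by (intro C_infinity_smooth_expr smooth_expr.add smooth_expr_approx_section;
          auto intro: smooth_expr.intros simp: add.commute)+
    ultimately show ?thesis by (simp add: smooth_sections_def)
  qed
  have meas_t [measurable]: "(\<lambda>z. t N 1 z) \<in> borel_measurable borel" for N
  proof -
    have "C_k 0 (\<lambda>z. t N 1 z)" using smooth by (simp add: smooth_sections_def C_infinity_def)
    then show ?thesis by (simp add: borel_measurable_continuous_onI)
  qed
  note meas [measurable]
  define C where "C = (\<Sum>j. norm (c j)) + (\<Sum>j. norm (d j))"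
  have lim: "(\<lambda>N. t N 1 z) \<longlonglongrightarrow> s 1 z" if "z \<noteq> 0" "norm z \<noteq> 1" for z
  proof (cases "norm z < 1")
    case True
    have "(\<lambda>N. z ^ m * approx_section m n' d N 1 (1 / z)) \<longlonglongrightarrow> z ^ m * 0"
      by (intro tendsto_mult_left approx_section_tendsto_outside d)
         (use that True in \<open>simp add: norm_divide\<close>)
    from tendsto_add[OF approx_section_tendsto_inside[OF c True, of m n] this] show ?thesis
      using that True by (simp add: t_def chart inside)
  next
    case False
    then have z: "norm z > 1" using that by simp
    have "(\<lambda>N. z ^ m * approx_section m n' d N 1 (1 / z)) \<longlonglongrightarrow> s 1 z"
      unfolding outside[OF z]
      by (intro tendsto_mult_left approx_section_tendsto_inside d)
         (use z in \<open>simp add: norm_divide divide_less_eq\<close>)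
    from tendsto_add[OF approx_section_tendsto_outside[OF c z, of m n] this] show ?thesis
      using that by (simp add: t_def chart)
  qed
  have bound: "norm (t N 1 z) \<le> C * max 1 (norm z) ^ m" if "z \<noteq> 0" for N z
  proof -
    have C0: "(\<Sum>j. norm (c j)) \<ge> 0" "(\<Sum>j. norm (d j)) \<ge> 0" by (auto intro!: suminf_nonneg c d)
    have "norm (approx_section m n c N 1 z) \<le> (\<Sum>j. norm (c j)) * max 1 (norm z) ^ m"
    proof (rule order_trans[OF norm_approx_section_affine_bound[OF c]])
      have "max 1 (norm z) ^ m \<ge> 1" by (rule one_le_power) simp
      from mult_left_mono[OF this C0(1)]
      show "(\<Sum>j. norm (c j)) \<le> (\<Sum>j. norm (c j)) * max 1 (norm z) ^ m" by simp
    qed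
    moreover have "norm (z ^ m * approx_section m n' d N 1 (1 / z)) \<le> max 1 (norm z) ^ m * (\<Sum>j. norm (d j))"
      unfolding norm_mult norm_power
      by (intro mult_mono norm_approx_section_affine_bound d power_mono) auto
    ultimately show ?thesis
      unfolding t_def chart[OF that] C_def distrib_right
      using norm_triangle_ineq[of "approx_section m n c N 1 z" "z ^ m * approx_section m n' d N 1 (1 / z)"]
      by (simp only: mult.commute)
  qed
  have s_bound: "norm (s 1 z) \<le> C * max 1 (norm z) ^ m" if "z \<noteq> 0" "norm z \<noteq> 1" for z
    by (rule LIMSEQ_le_const2[OF tendsto_norm[OF lim[OF that]]]) (use bound[OF that(1)] in blast)
  have p: "max 1 (norm z) ^ m > 0" for z :: complex
    by (intro zero_less_power) (simp add: less_max_iff_disj)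
  have h: "h_metric m u u 1 z = of_real ((norm (u 1 z) / max 1 (norm z) ^ m)\<^sup>2)" for u :: section_rep and z
  proof -
    have "u 1 z * cnj (u 1 z) = of_real ((norm (u 1 z))\<^sup>2)" by (simp only: complex_norm_square)
    moreover have "max (norm (1 :: complex)) (norm z) ^ (2 * m) = (max 1 (norm z) ^ m)\<^sup>2"
      by (simp only: power_mult[symmetric] mult.commute norm_one)
    ultimately show ?thesis by (simp only: h_metric_def power_divide of_real_divide)
  qed
  have hb: "norm (h_metric m u u 1 z) \<le> K\<^sup>2" if "norm (u 1 z) \<le> K * max 1 (norm z) ^ m" for u :: section_rep and z K
  proof -
    have "norm (u 1 z) / max 1 (norm z) ^ m \<le> K" using that by (simp only: pos_divide_le_eq[OF p])
    moreover have "norm (u 1 z) / max 1 (norm z) ^ m \<ge> 0" using p[of z] by simp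
    ultimately have "(norm (u 1 z) / max 1 (norm z) ^ m)\<^sup>2 \<le> K\<^sup>2" by (rule power_mono)
    then show ?thesis unfolding h norm_of_real by simp
  qed
  have meas_h: "(\<lambda>z. h_metric m u u 1 z) \<in> borel_measurable borel"
    if [measurable]: "(\<lambda>z. u 1 z) \<in> borel_measurable borel" for u :: section_rep
    unfolding h by (rule measurable_compose[OF _ borel_measurable_of_real]) measurable
  have "integrable omega_inf (\<lambda>z. h_metric m s s 1 z)"
  proof (rule finite_measure.integrable_const_bound[OF finite_measure_omega_inf])
    show "AE z in omega_inf. norm (h_metric m s s 1 z) \<le> C\<^sup>2"
    proof (rule eventually_mono[OF AE_omega_inf])
      fix z :: complex assume "z \<noteq> 0 \<and> norm z \<noteq> 1"
      then have "norm (s 1 z) \<le> C * max 1 (norm z) ^ m" using s_bound by blast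
      then show "norm (h_metric m s s 1 z) \<le> C\<^sup>2" by (rule hb[of s z C])
    qed
  qed (use meas_h[of s] meas in simp)
  then have "s \<in> L2_sections m" using sec meas by (simp add: L2_sections_def)
  moreover have "(\<lambda>N. L2_norm m (\<lambda>x0 x1. s x0 x1 - t N x0 x1)) \<longlonglongrightarrow> 0"
  proof -
    define e where "e N = (\<lambda>x0 x1. s x0 x1 - t N x0 x1)" for N
    have e: "e N 1 z = s 1 z - t N 1 z" for N z by (simp add: e_def)
    have meas_e: "(\<lambda>z. e N 1 z) \<in> borel_measurable borel" for N
      unfolding e by measurable
    have "(\<lambda>N. \<integral>z. h_metric m (e N) (e N) 1 z \<partial>omega_inf) \<longlonglongrightarrow> (\<integral>z. 0 \<partial>omega_inf)"
    proof (rule integral_dominated_convergence[where w = "\<lambda>_. (2 * C)\<^sup>2"])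
      show "AE z in omega_inf. (\<lambda>N. h_metric m (e N) (e N) 1 z) \<longlonglongrightarrow> 0"
      proof (rule eventually_mono[OF AE_omega_inf])
        fix z :: complex assume z: "z \<noteq> 0 \<and> norm z \<noteq> 1"
        have "(\<lambda>N. e N 1 z) \<longlonglongrightarrow> s 1 z - s 1 z"
          unfolding e using z by (intro tendsto_diff tendsto_const lim) auto
        then have "(\<lambda>N. complex_of_real ((norm (e N 1 z) / max 1 (norm z) ^ m)\<^sup>2))
            \<longlonglongrightarrow> of_real ((norm (s 1 z - s 1 z) / max 1 (norm z) ^ m)\<^sup>2)"
          using p[of z] by (intro tendsto_of_real tendsto_power tendsto_divide tendsto_norm tendsto_const) auto
        then show "(\<lambda>N. h_metric m (e N) (e N) 1 z) \<longlonglongrightarrow> 0"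
          unfolding h[of "e _"] by simp
      qed
      show "AE z in omega_inf. norm (h_metric m (e N) (e N) 1 z) \<le> (2 * C)\<^sup>2" for N
      proof (rule eventually_mono[OF AE_omega_inf])
        fix z :: complex assume z: "z \<noteq> 0 \<and> norm z \<noteq> 1"
        have "norm (s 1 z) \<le> C * max 1 (norm z) ^ m" "norm (t N 1 z) \<le> C * max 1 (norm z) ^ m"
          using z s_bound bound by blast+
        with norm_triangle_ineq4[of "s 1 z" "t N 1 z"]
        have "norm (e N 1 z) \<le> 2 * C * max 1 (norm z) ^ m" unfolding e by linarith
        then show "norm (h_metric m (e N) (e N) 1 z) \<le> (2 * C)\<^sup>2" by (rule hb[of "e N" z "2 * C"])
      qed
      show "(\<lambda>z. h_metric m (e N) (e N) 1 z) \<in> borel_measurable omega_inf" for N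
        using meas_h[of "e N", OF meas_e] by simp
    qed (simp_all add: finite_measure.integrable_const[OF finite_measure_omega_inf])
    then have "(\<lambda>N. L2_inner m (e N) (e N)) \<longlonglongrightarrow> 0"
      by (simp add: L2_inner_def)
    from tendsto_real_sqrt[OF tendsto_Re[OF this]] have "(\<lambda>N. L2_norm m (e N)) \<longlonglongrightarrow> 0"
      by (simp add: L2_norm_def)
    then show ?thesis by (simp only: e_def)
  qed
  moreover have "\<forall>N. t N \<in> smooth_sections m" using smooth by simp
  ultimately have "s \<in> L2_sections m \<and> (\<exists>t. (\<forall>k. t k \<in> smooth_sections m) \<and>
      (\<lambda>k. L2_norm m (\<lambda>x0 x1. s x0 x1 - t k x0 x1)) \<longlonglongrightarrow> 0)"
    by (intro conjI exI[of _ t])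
  then show ?thesis by (simp only: H_space_def mem_Collect_eq)
qed

section \<open>The glued Bessel sections\<close>

text \<open>The amplitudes of \<open>\<phi>\<close> in the two discs.  They unite the three cases in the definition of
  \<open>\<phi>\<close> into the single formula \<open>phi_affine\<close>.\<close>

definition amp_in :: "nat \<Rightarrow> int \<Rightarrow> complex \<Rightarrow> complex" where
  "amp_in m n l = (if m \<ge> 1 \<or> bessel_J' n l = 0 then 1 else - 1)"

definition amp_out :: "nat \<Rightarrow> int \<Rightarrow> complex \<Rightarrow> complex" where
  "amp_out m n l = (if m \<ge> 1 then bessel_J n l / bessel_J (n - int m) l else 1)"

text \<open>For \<open>m \<ge> 1\<close> the quotient of Bessel values enforces continuity, and the second condition is then
  \<open>L(\<lambda>) = 0\<close> divided by \<open>J\<^sub>n\<^sub>-\<^sub>m(\<lambda>)\<close>.  For \<open>m = 0\<close> the equation \<open>L(\<lambda>) = 0\<close> says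
  \<open>J\<^sub>n(\<lambda>) J\<^sub>n'(\<lambda>) = 0\<close>: the even gluing suits a zero of \<open>J\<^sub>n'\<close>, the odd gluing a zero of \<open>J\<^sub>n\<close>.\<close>

lemma transmission_Z_adm:
  assumes "l \<in> Z_adm m n"
  shows "transmission m n l (amp_in m n l) (amp_out m n l)"
proof (cases "m = 0")
  case True
  then have "bessel_J' n l = 0 \<or> bessel_J n l = 0"
    using assms by (auto simp: Z_adm_def Z_set_iff L_entire_def)
  then show ?thesis using True by (auto simp: transmission_def amp_in_def amp_out_def)
next
  case False
  let ?J = "bessel_J n l" and ?K = "bessel_J (n - int m) l"
  have K: "?J \<noteq> 0" "?K \<noteq> 0" and L: "L_entire m n l = 0"
    using assms False by (auto simp: Z_adm_def Z_set_iff)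
  have "l * bessel_J' n l + ?J / ?K * (l * bessel_J' (n - int m) l)
      = (l * bessel_J' n l * ?K + ?J * (l * bessel_J' (n - int m) l)) / ?K"
    using K by (simp add: add_divide_distrib)
  also have "\<dots> = of_nat m * ?J * ?K / ?K"
    using L by (simp add: L_entire_def)
  finally show ?thesis using False K by (simp add: transmission_def amp_in_def amp_out_def)
qed

text \<open>Integer powers of \<open>sgn z\<close> are multiplicative in \<open>z\<close>, which \<open>Arg\<close> is only up to a full turn.\<close>

lemma cis_Arg_power_int: "z \<noteq> 0 \<Longrightarrow> cis (of_int n * Arg z) = sgn z powi n"
  using cis_power_int[of "Arg z" n] by (simp add: cis_Arg)

lemma phi_affine:
  "phi m n l 1 z = (if norm z < 1 then amp_in m n l * bessel_J n (l * of_real (norm z))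
      else amp_out m n l * of_real (norm z) ^ m * bessel_J (n - int m) (l / of_real (norm z)))
     * cis (of_int n * Arg z)"
  by (cases "m = 0") (auto simp: phi_def tensor_one_def f_fun_def Let_def amp_in_def amp_out_def)

lemma is_section_phi: "is_section m (phi m n l)"
  by (auto simp: is_section_def phi_def tensor_one_def power_mult_distrib)

lemma measurable_phi: "(\<lambda>z. phi m n l 1 z) \<in> borel_measurable borel"
proof -
  have [measurable]: "bessel_J n \<in> borel_measurable borel" for n
    by (rule borel_measurable_continuous_onI[OF holomorphic_on_imp_continuous_on[OF holomorphic_bessel_J]])
  have [measurable]: "(\<lambda>z. cis (of_int n * Arg z)) \<in> borel_measurable borel"
  proof -
    have "(\<lambda>z. if z \<in> {0} then 1 else sgn z powi n :: complex) \<in> borel_measurable borel"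
      by (rule borel_measurable_continuous_on_if) (auto intro!: continuous_intros simp: sgn_zero_iff)
    also have "(\<lambda>z. if z \<in> {0} then 1 else sgn z powi n) = (\<lambda>z. cis (of_int n * Arg z))"
      by (auto simp: fun_eq_iff cis_Arg_power_int Arg_zero)
    finally show ?thesis .
  qed
  show ?thesis unfolding phi_affine by measurable
qed

lemma cnj_unit:
  assumes "norm u = 1"
  shows "cnj u = inverse u"
proof -
  have "u * cnj u = 1" using assms complex_norm_square[of u] by simp
  then show ?thesis by (rule inverse_unique[symmetric])
qed

definition mode_coeff :: "int \<Rightarrow> complex \<Rightarrow> nat \<Rightarrow> complex" where
  "mode_coeff n l j = bessel_sign n * (l / 2) ^ nat \<bar>n\<bar> * (bessel_coeff (nat \<bar>n\<bar>) j * (l\<^sup>2) ^ j)"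

lemma summable_mode_coeff: "summable (\<lambda>j. norm (a * mode_coeff n l j))"
  unfolding mode_coeff_def norm_mult[of a] norm_mult[of "_ * _ ^ _"]
  by (intro summable_mult summable_norm_bessel)

lemma monomial_polar:
  assumes "z \<noteq> 0"
  shows "z ^ hol_exp n j * cnj z ^ antihol_exp n j = of_real (norm z) ^ (nat \<bar>n\<bar> + 2 * j) * sgn z powi n"
proof -
  define r u where "r = complex_of_real (norm z)" and "u = sgn z"
  have u: "u \<noteq> 0" "cnj u = inverse u" and z: "z = r * u" and r: "cnj r = r"
    using assms by (simp_all add: u_def r_def sgn_zero_iff cnj_unit norm_sgn) (simp add: sgn_eq)
  have "z ^ hol_exp n j * cnj z ^ antihol_exp n j
      = r ^ (hol_exp n j + antihol_exp n j) * (u ^ hol_exp n j * inverse u ^ antihol_exp n j)"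
    unfolding z complex_cnj_mult r u(2) power_mult_distrib power_add by (simp only: mult_ac)
  also have "u ^ hol_exp n j * inverse u ^ antihol_exp n j = u powi (int (hol_exp n j) - int (antihol_exp n j))"
    using u(1) by (simp add: power_int_diff power_inverse divide_inverse)
  also have "int (hol_exp n j) - int (antihol_exp n j) = n"
    by (auto simp: hol_exp_def antihol_exp_def)
  finally show ?thesis by (simp only: exp_sum r_def u_def)
qed

lemma bessel_mode_expansion:
  assumes "z \<noteq> 0"
  shows "bessel_J n (l * of_real (norm z)) * sgn z powi n
    = (\<Sum>j. mode_coeff n l j * (z ^ hol_exp n j * cnj z ^ antihol_exp n j))"
proof -
  let ?a = "nat \<bar>n\<bar>"
  define r where "r = complex_of_real (norm z)"
  have "(\<lambda>j. bessel_coeff ?a j * ((l * r)\<^sup>2) ^ j) sums bessel_series ?a ((l * r)\<^sup>2)"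
    unfolding bessel_series_def by (rule summable_sums[OF summable_bessel])
  then have "(\<lambda>j. bessel_sign n * (l * r / 2) ^ ?a * sgn z powi n * (bessel_coeff ?a j * ((l * r)\<^sup>2) ^ j))
      sums (bessel_sign n * (l * r / 2) ^ ?a * sgn z powi n * bessel_series ?a ((l * r)\<^sup>2))"
    by (rule sums_mult)
  also have "(\<lambda>j. bessel_sign n * (l * r / 2) ^ ?a * sgn z powi n * (bessel_coeff ?a j * ((l * r)\<^sup>2) ^ j))
      = (\<lambda>j. mode_coeff n l j * (z ^ hol_exp n j * cnj z ^ antihol_exp n j))"
    unfolding monomial_polar[OF assms] mode_coeff_def r_def
    by (simp add: fun_eq_iff power_mult_distrib power_add power_divide power_mult[symmetric] mult_ac)
  finally show ?thesis
    by (simp only: sums_iff bessel_J_series r_def) (simp only: mult_ac)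
qed

text \<open>In the coordinate \<open>1 / z\<close> the outer half is a Bessel mode of frequency \<open>m - n\<close>; the two signs convert
  \<open>J\<^sub>n\<^sub>-\<^sub>m\<close> into \<open>J\<^sub>m\<^sub>-\<^sub>n\<close>.\<close>

lemma phi_in_H_space: "phi m n l \<in> H_space m"
proof (rule H_spaceI[OF is_section_phi measurable_phi])
  let ?k = "n - int m"
  show "summable (\<lambda>j. norm (amp_in m n l * mode_coeff n l j))"
    by (rule summable_mode_coeff)
  show "summable (\<lambda>j. norm (amp_out m n l * bessel_sign ?k * bessel_sign (- ?k) * mode_coeff (- ?k) l j))"
    by (rule summable_mode_coeff)
  have mode_summable: "summable (\<lambda>j. mode_coeff n l j * (z ^ hol_exp n j * cnj z ^ antihol_exp n j))"
    if "norm z < 1" for n z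
    using summable_monomials[OF summable_mode_coeff[of 1] that] by simp
  show "phi m n l 1 z = (\<Sum>j. amp_in m n l * mode_coeff n l j * (z ^ hol_exp n j * cnj z ^ antihol_exp n j))"
    if "z \<noteq> 0" "norm z < 1" for z
    unfolding mult.assoc[of "amp_in m n l"] suminf_mult[OF mode_summable[OF that(2)]]
      bessel_mode_expansion[OF that(1), symmetric]
    using that by (simp add: phi_affine cis_Arg_power_int)
  show "phi m n l 1 z = z ^ m * (\<Sum>j. amp_out m n l * bessel_sign ?k * bessel_sign (- ?k) * mode_coeff (- ?k) l j *
      ((1 / z) ^ hol_exp (- ?k) j * cnj (1 / z) ^ antihol_exp (- ?k) j))" if z: "norm z > 1" for z
  proof -
    have z0: "z \<noteq> 0" "1 / z \<noteq> 0" "norm (1 / z) < 1" using z by (auto simp: norm_divide divide_less_eq)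
    have sign: "bessel_sign ?k * bessel_sign (- ?k) * bessel_J (- ?k) w = bessel_J ?k w" for w
      by (auto simp: bessel_J_series bessel_sign_def abs_minus_commute power_mult_distrib[symmetric])
    have u: "z ^ m * (sgn (1 / z)) powi (- ?k) = of_real (norm z) ^ m * sgn z powi n"
    proof -
      have s: "sgn z \<noteq> 0" using z0 by (simp add: sgn_zero_iff)
      have "sgn (1 / z) powi (- ?k) = sgn z powi ?k"
      proof -
        have "sgn (1 / z) = inverse (sgn z)" by (simp add: sgn_divide inverse_eq_divide)
        then show ?thesis by (simp only: power_int_minus power_int_inverse inverse_inverse_eq)
      qed
      moreover have "z = of_real (norm z) * sgn z" using z0 by (simp add: sgn_eq)
      then have "z ^ m = of_real (norm z) ^ m * sgn z ^ m" by (metis power_mult_distrib)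
      moreover have "sgn z ^ m * sgn z powi ?k = sgn z powi n"
        using s by (simp add: power_int_diff)
      ultimately show ?thesis by simp
    qed
    have "z ^ m * (\<Sum>j. amp_out m n l * bessel_sign ?k * bessel_sign (- ?k) * mode_coeff (- ?k) l j *
      ((1 / z) ^ hol_exp (- ?k) j * cnj (1 / z) ^ antihol_exp (- ?k) j))
     = z ^ m * (amp_out m n l * bessel_sign ?k * bessel_sign (- ?k) *
         (bessel_J (- ?k) (l * of_real (norm (1 / z))) * sgn (1 / z) powi (- ?k)))"
      unfolding mult.assoc[of "amp_out m n l * bessel_sign ?k * bessel_sign (- ?k)"]
        suminf_mult[OF mode_summable[OF z0(3)]] bessel_mode_expansion[OF z0(2), symmetric] ..
    also have "\<dots> = amp_out m n l * (bessel_sign ?k * bessel_sign (- ?k) * bessel_J (- ?k) (l * of_real (norm (1 / z))))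
        * (z ^ m * sgn (1 / z) powi (- ?k))"
      by (simp only: mult_ac)
    also have "\<dots> = phi m n l 1 z"
      unfolding sign u using z z0 by (simp add: phi_affine cis_Arg_power_int norm_divide)
    finally show ?thesis ..
  qed
qed

lemma phi_rotate:
  assumes "norm u = 1" "z \<noteq> 0"
  shows "phi m n l 1 (u * z) = u powi n * phi m n l 1 z"
proof -
  have "u \<noteq> 0" "sgn u = u" using assms(1) by (auto simp: sgn_eq)
  then have "cis (of_int n * Arg (u * z)) = u powi n * cis (of_int n * Arg z)"
    using assms(2) by (simp add: cis_Arg_power_int sgn_mult power_int_mult_distrib)
  then show ?thesis unfolding phi_affine norm_mult assms(1) by simp
qed

lemma L2_inner_phi_different_mode:
  assumes "n \<noteq> n'"
  shows "L2_inner m (phi m n l) (phi m n' l') = 0"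
  unfolding L2_inner_def
proof (rule omega_inf_rotation_zero)
  show "n - n' \<noteq> 0" using assms by simp
  have [measurable]: "(\<lambda>z. cnj (phi m n' l' 1 z)) \<in> borel_measurable borel"
    by (rule measurable_compose[OF measurable_phi borel_measurable_continuous_onI]) (intro continuous_intros)
  note measurable_phi[measurable]
  show "(\<lambda>z. h_metric m (phi m n l) (phi m n' l') 1 z) \<in> borel_measurable borel"
    unfolding h_metric_def by measurable
  fix u z :: complex assume u: "norm u = 1" and z: "z \<noteq> 0"
  have "u \<noteq> 0" using u by auto
  moreover have "cnj u = inverse u" using u by (rule cnj_unit)
  ultimately have "u powi n * cnj (u powi n') = u powi (n - n')"
    by (simp add: power_int_diff power_int_inverse divide_inverse)
  then show "h_metric m (phi m n l) (phi m n' l') 1 (u * z) = u powi (n - n') * h_metric m (phi m n l) (phi m n' l') 1 z"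
    unfolding h_metric_def phi_rotate[OF u z] norm_mult u by (simp add: mult_ac)
qed

lemma Z_adm_cnj:
  assumes "l \<in> Z_adm m n"
  shows "l \<noteq> 0" "cnj l = l" "cnj (bessel_J k (l * of_real r)) = bessel_J k (l * of_real r)"
    "cnj (amp_in m n l) = amp_in m n l" "cnj (amp_out m n l) = amp_out m n l"
proof -
  show 0: "l \<noteq> 0" "cnj l = l"
    using assms Z_set_real[of m n] by (auto simp: Z_adm_def Reals_cnj_iff)
  show "cnj (bessel_J k (l * of_real r)) = bessel_J k (l * of_real r)"
    "cnj (amp_in m n l) = amp_in m n l" "cnj (amp_out m n l) = amp_out m n l"
    using 0 by (simp_all add: amp_in_def amp_out_def flip: cnj_bessel_J)
qed

text \<open>The phases cancel, and on the outer disc \<open>r\<^sup>2\<^sup>m\<close> cancels against the metric, so the integrand is a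
  radial function on each disc.\<close>

lemma L2_inner_phi_same_mode:
  assumes l: "l \<in> Z_adm m n" and l': "l' \<in> Z_adm m n"
  shows "L2_inner m (phi m n l) (phi m n l') =
     2 * (amp_in m n l * amp_in m n l' * lommel n l l'
        + amp_out m n l * amp_out m n l' * lommel (n - int m) l l')"
proof -
  let ?k = "n - int m"
  define P where "P r = amp_in m n l * amp_in m n l' * (bessel_J n (l * of_real r) * bessel_J n (l' * of_real r))" for r :: real
  define Q where "Q r = amp_out m n l * amp_out m n l' * (bessel_J ?k (l * of_real r) * bessel_J ?k (l' * of_real r))" for r :: real
  have h: "h_metric m (phi m n l) (phi m n l') 1 z = (if norm z < 1 then P (norm z) else Q (1 / norm z))" for z
  proof -
    define e where "e = cis (of_int n * Arg z)"
    have e: "e * cnj e = 1" by (simp add: e_def cis_cnj cis_mult)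
    show ?thesis
    proof (cases "norm z < 1")
      case True
      then have "h_metric m (phi m n l) (phi m n l') 1 z = P (norm z) * (e * cnj e)"
        unfolding h_metric_def phi_affine e_def[symmetric]
        by (simp add: P_def Z_adm_cnj[OF l'] mult_ac)
      then show ?thesis using True e by simp
    next
      case False
      define r where "r = norm z"
      have r: "r \<ge> 1" using False by (simp add: r_def)
      have "h_metric m (phi m n l) (phi m n l') 1 z = Q (1 / r) * (e * cnj e) * (of_real r ^ m * of_real r ^ m / of_real r ^ (2 * m))"
        using False Z_adm_cnj(3)[OF l', of ?k "1 / r"]
        unfolding h_metric_def phi_affine e_def[symmetric]
        by (simp add: Q_def Z_adm_cnj[OF l'] mult_ac max_def r_def)
      also have "of_real r ^ m * of_real r ^ m / of_real r ^ (2 * m) = (1 :: complex)"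
        using r by (simp add: mult_2 power_add)
      finally show ?thesis using False e by (simp add: r_def)
    qed
  qed
  have "L2_inner m (phi m n l) (phi m n l')
      = 2 * integral {0..1} (\<lambda>r. of_real r * P r) + 2 * integral {0..1} (\<lambda>r. of_real r * Q r)"
    unfolding L2_inner_def h
    by (rule integral_omega_inf_radial; unfold P_def Q_def; intro continuous_intros)
  moreover have "integral {0..1} (\<lambda>r. of_real r * P r) = amp_in m n l * amp_in m n l' * lommel n l l'"
    using has_integral_mult_right[OF has_integral_lommel[of n l l'], of "amp_in m n l * amp_in m n l'"]
    by (intro integral_unique) (simp add: P_def mult_ac)
  moreover have "integral {0..1} (\<lambda>r. of_real r * Q r) = amp_out m n l * amp_out m n l' * lommel ?k l l'"
    using has_integral_mult_right[OF has_integral_lommel[of ?k l l'], of "amp_out m n l * amp_out m n l'"]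
    by (intro integral_unique) (simp add: Q_def mult_ac)
  ultimately show ?thesis by (simp add: distrib_left)
qed

lemma L2_inner_phi_orthogonal:
  assumes l: "l \<in> Z_adm m n" and l': "l' \<in> Z_adm m n" and ne: "l \<noteq> l'" "l' \<noteq> - l"
  shows "L2_inner m (phi m n l) (phi m n l') = 0"
proof -
  have "l\<^sup>2 \<noteq> l'\<^sup>2" using ne by (auto simp: power2_eq_iff)
  then show ?thesis
    unfolding L2_inner_phi_same_mode[OF l l']
    using transmission_orthogonal[OF Z_adm_cnj(1)[OF l] Z_adm_cnj(1)[OF l'] _ transmission_Z_adm[OF l] transmission_Z_adm[OF l']]
    by simp
qed

text \<open>The squared norm is the square of a square root of a real part; the inner product is real and
  nonnegative because \<open>\<lambda>\<close> and the amplitudes are real.\<close>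

lemma L2_norm_phi:
  assumes l: "l \<in> Z_adm m n"
  shows "complex_of_real ((L2_norm m (phi m n l))\<^sup>2)
     = (amp_in m n l)\<^sup>2 * ((bessel_J' n l)\<^sup>2 + (1 - of_int n ^ 2 / l\<^sup>2) * (bessel_J n l)\<^sup>2)
       + (amp_out m n l)\<^sup>2 * ((bessel_J' (n - int m) l)\<^sup>2
          + (1 - of_int (n - int m) ^ 2 / l\<^sup>2) * (bessel_J (n - int m) l)\<^sup>2)"
proof -
  let ?k = "n - int m" and ?a = "amp_in m n l" and ?b = "amp_out m n l"
  note real = Z_adm_cnj[OF l]
  obtain p where p: "p > 0" "lommel n l l = of_real p"
    using lommel_cnj_pos[OF real(1), of n] real(2) by metis
  obtain q where q: "q > 0" "lommel ?k l l = of_real q"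
    using lommel_cnj_pos[OF real(1), of ?k] real(2) by metis
  have sq: "?a * ?a = of_real ((norm ?a)\<^sup>2)" "?b * ?b = of_real ((norm ?b)\<^sup>2)"
    unfolding complex_norm_square using real by simp_all
  have I: "L2_inner m (phi m n l) (phi m n l) = of_real (2 * ((norm ?a)\<^sup>2 * p + (norm ?b)\<^sup>2 * q))"
    unfolding L2_inner_phi_same_mode[OF l l] p q sq by simp
  have "2 * ((norm ?a)\<^sup>2 * p + (norm ?b)\<^sup>2 * q) \<ge> 0" using p q by simp
  then have "(L2_norm m (phi m n l))\<^sup>2 = 2 * ((norm ?a)\<^sup>2 * p + (norm ?b)\<^sup>2 * q)"
    unfolding L2_norm_def I by simp
  then have "complex_of_real ((L2_norm m (phi m n l))\<^sup>2) = L2_inner m (phi m n l) (phi m n l)"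
    unfolding I by (simp only:)
  also have "\<dots> = ?a\<^sup>2 * (2 * lommel n l l) + ?b\<^sup>2 * (2 * lommel ?k l l)"
    unfolding L2_inner_phi_same_mode[OF l l] by (simp add: power2_eq_square algebra_simps)
  finally show ?thesis unfolding lommel_diagonal[OF real(1)] .
qed

theorem mainTheorem8:
  fixes m :: nat and n :: int
  shows
    "(\<forall>l \<in> Z_adm m n. phi m n l \<in> H_space m) \<and>
     (\<forall>l \<in> Z_adm m n.
        (bessel_J n l \<noteq> 0 \<longrightarrow>
          complex_of_real ((L2_norm m (phi m n l))\<^sup>2) =
            2 * ((bessel_J n l)\<^sup>2 / 2 *
                   ((bessel_J' n l)\<^sup>2 / (bessel_J n l)\<^sup>2
                    + (bessel_J' (n - int m) l)\<^sup>2 / (bessel_J (n - int m) l)\<^sup>2)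
                 + (bessel_J n l)\<^sup>2 / 2 *
                   (2 - (of_int (n - int m) ^ 2 + of_int n ^ 2) / l\<^sup>2))) \<and>
        (m = 0 \<and> bessel_J n l = 0 \<longrightarrow>
          complex_of_real ((L2_norm m (phi m n l))\<^sup>2) =
            2 * (1 / 2 * ((bessel_J' n l)\<^sup>2 + (bessel_J' n l)\<^sup>2)))) \<and>
     (\<forall>n n'. \<forall>l \<in> Z_adm m n. \<forall>l' \<in> Z_adm m n'.
        \<not> (n = n' \<and> l' = - l) \<longrightarrow>
        L2_inner m (phi m n l) (phi m n' l') =
          of_bool (n = n') * of_bool (l = l') * L2_inner m (phi m n l) (phi m n l)) \<and>
     (Z_set m n \<subseteq> \<real> - {0} \<and> discrete (Z_set m n) \<and> infinite (Z_set m n))"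
proof (intro conjI ballI allI impI)
  show "phi m n l \<in> H_space m" for l by (rule phi_in_H_space)
next
  fix l assume l: "l \<in> Z_adm m n" and J: "bessel_J n l \<noteq> 0"
  let ?J = "bessel_J n l" and ?J' = "bessel_J' n l"
    and ?K = "bessel_J (n - int m) l" and ?K' = "bessel_J' (n - int m) l"
  let ?N = "complex_of_int n ^ 2" and ?M = "complex_of_int (n - int m) ^ 2"
  have l0: "l \<noteq> 0" by (rule Z_adm_cnj(1)[OF l])
  have amp: "(amp_in m n l)\<^sup>2 = 1" "amp_out m n l = ?J / ?K" and K: "?K \<noteq> 0"
    using l J by (cases "m = 0"; auto simp: amp_in_def amp_out_def Z_adm_def)+
  have "complex_of_real ((L2_norm m (phi m n l))\<^sup>2)
      = (?J'\<^sup>2 + (1 - ?N / l\<^sup>2) * ?J\<^sup>2) + (?J / ?K)\<^sup>2 * (?K'\<^sup>2 + (1 - ?M / l\<^sup>2) * ?K\<^sup>2)"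
    unfolding L2_norm_phi[OF l] amp by simp
  also have "\<dots> = 2 * (?J\<^sup>2 / 2 * (?J'\<^sup>2 / ?J\<^sup>2 + ?K'\<^sup>2 / ?K\<^sup>2) + ?J\<^sup>2 / 2 * (2 - (?M + ?N) / l\<^sup>2))"
    using J K l0 by (simp add: field_simps)
  finally show "complex_of_real ((L2_norm m (phi m n l))\<^sup>2) =
      2 * (?J\<^sup>2 / 2 * (?J'\<^sup>2 / ?J\<^sup>2 + ?K'\<^sup>2 / ?K\<^sup>2) + ?J\<^sup>2 / 2 * (2 - (?M + ?N) / l\<^sup>2))" .
next
  fix l assume l: "l \<in> Z_adm m n" and "m = 0 \<and> bessel_J n l = 0"
  then show "complex_of_real ((L2_norm m (phi m n l))\<^sup>2) =
      2 * (1 / 2 * ((bessel_J' n l)\<^sup>2 + (bessel_J' n l)\<^sup>2))"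
    unfolding L2_norm_phi[OF l] by (simp add: amp_in_def amp_out_def)
next
  fix n n' l l'
  assume "l \<in> Z_adm m n" "l' \<in> Z_adm m n'" "\<not> (n = n' \<and> l' = - l)"
  then show "L2_inner m (phi m n l) (phi m n' l') =
      of_bool (n = n') * of_bool (l = l') * L2_inner m (phi m n l) (phi m n l)"
    using L2_inner_phi_different_mode[of n n' m l l'] L2_inner_phi_orthogonal[of l m n l'] by auto
next
  show "Z_set m n \<subseteq> \<real> - {0}" by (rule Z_set_real)
  show "discrete (Z_set m n)" by (rule discrete_Z_set)
  show "infinite (Z_set m n)" by (rule infinite_Z_set)
qed

end
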